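(* Let $\beta>0$ and $\alpha\in(1,+\infty)$. Then the walk $X$ localizes on exactly 3 sites almost surely, i.e. $|R'|=3$ almost surely.
   Context: Let $\alpha\in\mathbb{R}$ and $\beta>0$. Let $(X_k)_{k\ge0}$ be the nearest-neighbour random walk on $\mathbb{Z}$ with $X_0=0$ defined as follows. For $k\ge0$ and $j\in\mathbb{Z}$, let $l_k(j):=\#\{m\in\{1,\dots,k\}:\{X_{m-1},X_m\}=\{j-1,j\}\}$ be the local time of the non-oriented edge $\{j-1,j\}$ up to time $k$, let $\mathcal{F}_k=\sigma(X_0,\dots,X_k)$, and let $\Delta_k(j):=-\alpha l_k(j-1)+l_k(j)-l_k(j+1)+\alpha l_k(j+2)$. The transition probabilities are $\mathbb{P}(X_{k+1}=X_k\pm1\mid\mathcal{F}_k)=\dfrac{e^{\pm\beta\Delta_k(X_k)}}{e^{\beta\Delta_k(X_k)}+e^{-\beta\Delta_k(X_k)}}$. Let $Z_k(j):=\sum_{m=1}^k\mathbf{1}_{\{X_m=j\}}$, $Z_\infty(j):=\lim_{k\to\infty}Z_k(j)$, and $R':=\{j\in\mathbb{Z}:Z_\infty(j)=\infty\}$. *)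

theory Defs
  imports "HOL-Probability.Probability"
begin

definition edge_local_time :: "(nat \<Rightarrow> int) \<Rightarrow> nat \<Rightarrow> int \<Rightarrow> nat" where
  "edge_local_time p k j = card {m. 1 \<le> m \<and> m \<le> k \<and> {p (m - 1), p m} = {j - 1, j}}"

definition Delta :: "real \<Rightarrow> (nat \<Rightarrow> int) \<Rightarrow> nat \<Rightarrow> int \<Rightarrow> real" where
  "Delta \<alpha> p k j = - \<alpha> * real (edge_local_time p k (j - 1)) + real (edge_local_time p k j)
     - real (edge_local_time p k (j + 1)) + \<alpha> * real (edge_local_time p k (j + 2))"

definition step_prob :: "real \<Rightarrow> real \<Rightarrow> (nat \<Rightarrow> int) \<Rightarrow> nat \<Rightarrow> int \<Rightarrow> real" where
  "step_prob \<alpha> \<beta> p k s =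
     (let d = Delta \<alpha> p k (p k) in exp (real_of_int s * \<beta> * d) / (exp (\<beta> * d) + exp (- \<beta> * d)))"

definition trans_prob :: "real \<Rightarrow> real \<Rightarrow> (nat \<Rightarrow> int) \<Rightarrow> nat \<Rightarrow> int \<Rightarrow> real" where
  "trans_prob \<alpha> \<beta> p k y =
     (if y = p k + 1 then step_prob \<alpha> \<beta> p k 1
      else if y = p k - 1 then step_prob \<alpha> \<beta> p k (-1) else 0)"

text \<open>X is the walk of the paper on the probability space M: X_0 = 0 and the
  finite-dimensional distributions are given by the transition probabilities
  (equivalently, P(X_{k+1} = y | F_k) = trans_prob (X_0..X_k) y).\<close>
definition is_walk :: "'w measure \<Rightarrow> real \<Rightarrow> real \<Rightarrow> (nat \<Rightarrow> 'w \<Rightarrow> int) \<Rightarrow> bool" where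
  "is_walk M \<alpha> \<beta> X \<longleftrightarrow>
     (\<forall>i. X i \<in> measurable M (count_space UNIV)) \<and>
     (AE \<omega> in M. X 0 \<omega> = 0) \<and>
     (\<forall>k (xs :: nat \<Rightarrow> int).
        measure M {\<omega> \<in> space M. \<forall>i \<le> Suc k. X i \<omega> = xs i}
        = measure M {\<omega> \<in> space M. \<forall>i \<le> k. X i \<omega> = xs i} * trans_prob \<alpha> \<beta> xs k (xs (Suc k)))"

definition R_inf :: "(nat \<Rightarrow> 'w \<Rightarrow> int) \<Rightarrow> 'w \<Rightarrow> int set" where
  "R_inf X \<omega> = {j. infinite {m. 1 \<le> m \<and> X m \<omega> = j}}"

end

theory Submission
  imports Defs
begin

text \<open>
  Put \<open>g(e) = (\<alpha> - 1) l(e) + \<alpha> (l(e - 1) + l(e + 1))\<close>. Then \<open>\<Delta>(j) = g(j + 1) - g(j)\<close>, so the walk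
  is a reinforced random walk with edge weights \<open>exp (2 \<beta> g(e))\<close>, and for \<open>\<alpha> > 1\<close> all coefficients of
  \<open>g\<close> are positive. Infinitely often the walk is next to an edge whose potential is within \<open>\<alpha>\<close> of the
  global maximum: otherwise \<open>g\<close> stays bounded, which has probability zero. From each such
  configuration it gets stuck on three sites with a probability bounded from below, so by Levy's 0-1
  law it almost surely gets stuck. For the lower bound, the walk first makes round trips on the two
  chosen edges until their potentials dominate those of the next-to-neighbouring edges; after that,
  \<open>exp (2 \<beta> (g(z + 2) - g(z))) + exp (2 \<beta> (g(z - 1) - g(z + 1)))\<close>, observed at the middle site \<open>z\<close>,
  is up to a constant factor a supermartingale that dominates the exit probability. Finally the walk cannot
  stay on two sites, since crossing an edge only favours its neighbours.
\<close>

section \<open>The edge potential\<close>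

definition pot :: "real \<Rightarrow> (nat \<Rightarrow> int) \<Rightarrow> nat \<Rightarrow> int \<Rightarrow> real" where
  "pot \<alpha> p n e = (\<alpha> - 1) * real (edge_local_time p n e)
     + \<alpha> * (real (edge_local_time p n (e - 1)) + real (edge_local_time p n (e + 1)))"

text \<open>The effect of one crossing of edge \<open>e\<close>. An edge is named by its right
  endpoint: \<open>e\<close> joins the sites \<open>e - 1\<close> and \<open>e\<close>.\<close>

definition bump :: "real \<Rightarrow> int \<Rightarrow> (int \<Rightarrow> real) \<Rightarrow> int \<Rightarrow> real" where
  "bump \<alpha> e g i = g i + (if i = e then \<alpha> - 1 else if i = e - 1 \<or> i = e + 1 then \<alpha> else 0)"

text \<open>The logistic function: the probability of choosing the edge whose potential exceeds that
  of the other edge at the current site by \<open>t\<close>.\<close>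

definition sg :: "real \<Rightarrow> real \<Rightarrow> real" where
  "sg \<beta> t = 1 / (1 + exp (- (2 * \<beta> * t)))"

lemma Delta_eq_pot: "Delta \<alpha> p n j = pot \<alpha> p n (j + 1) - pot \<alpha> p n j"
  by (simp add: Delta_def pot_def algebra_simps)

lemma insert_if:
  assumes "\<And>m. m \<in> A' \<longleftrightarrow> m \<in> A \<or> m = a \<and> C"
  shows "A' = (if C then insert a A else A)"
  using assms by auto

lemma edge_local_time_Suc:
  "edge_local_time p (Suc n) j
    = edge_local_time p n j + (if {p n, p (Suc n)} = {j - 1, j} then 1 else 0)"
proof -
  let ?S = "\<lambda>k. {m. 1 \<le> m \<and> m \<le> k \<and> {p (m - 1), p m} = {j - 1, j}}"
  have fin: "finite (?S n)"
    by (rule finite_subset[of _ "{..n}"]) auto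
  have iff: "m \<in> ?S (Suc n) \<longleftrightarrow> m \<in> ?S n \<or> m = Suc n \<and> {p n, p (Suc n)} = {j - 1, j}" for m
    by (cases "m = Suc n") (simp, simp add: le_Suc_eq)
  have "?S (Suc n) = (if {p n, p (Suc n)} = {j - 1, j} then insert (Suc n) (?S n) else ?S n)"
    using iff by (rule insert_if)
  with fin show ?thesis
    unfolding edge_local_time_def by (simp del: One_nat_def)
qed

lemma edge_local_time_cong:
  assumes "\<And>i. i \<le> n \<Longrightarrow> p i = p' i"
  shows "edge_local_time p n j = edge_local_time p' n j"
proof -
  have "{m. 1 \<le> m \<and> m \<le> n \<and> {p (m - 1), p m} = {j - 1, j}}
    = {m. 1 \<le> m \<and> m \<le> n \<and> {p' (m - 1), p' m} = {j - 1, j}}"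
    using assms by auto
  then show ?thesis
    by (simp add: edge_local_time_def)
qed

lemma pot_cong:
  assumes "\<And>i. i \<le> n \<Longrightarrow> p i = p' i"
  shows "pot \<alpha> p n = pot \<alpha> p' n"
  using edge_local_time_cong[OF assms] by (auto simp: pot_def fun_eq_iff)

lemma pot_nonneg: "\<alpha> > 1 \<Longrightarrow> 0 \<le> pot \<alpha> p n e"
  by (simp add: pot_def)

lemma pot_Suc_right:
  assumes "p (Suc n) = p n + 1"
  shows "pot \<alpha> p (Suc n) = bump \<alpha> (p n + 1) (pot \<alpha> p n)"
proof -
  have "edge_local_time p (Suc n) j = edge_local_time p n j + (if j = p n + 1 then 1 else 0)" for j
    using assms by (auto simp: edge_local_time_Suc doubleton_eq_iff)
  then show ?thesis
    by (auto simp: fun_eq_iff pot_def bump_def algebra_simps)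
qed

lemma pot_Suc_left:
  assumes "p (Suc n) = p n - 1"
  shows "pot \<alpha> p (Suc n) = bump \<alpha> (p n) (pot \<alpha> p n)"
proof -
  have "edge_local_time p (Suc n) j = edge_local_time p n j + (if j = p n then 1 else 0)" for j
    using assms by (auto simp: edge_local_time_Suc doubleton_eq_iff)
  then show ?thesis
    by (auto simp: fun_eq_iff pot_def bump_def algebra_simps)
qed

section \<open>Logistic step probabilities\<close>

lemma sg_pos: "0 < sg \<beta> t"
  by (simp add: sg_def add_pos_pos)

lemma sg_le_1: "sg \<beta> t \<le> 1"
  by (simp add: sg_def add_pos_pos)

lemma sg_mono: "\<beta> > 0 \<Longrightarrow> s \<le> t \<Longrightarrow> sg \<beta> s \<le> sg \<beta> t"
  by (simp add: sg_def frac_le add_pos_pos)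

lemma sg_minus: "sg \<beta> (- t) = 1 - sg \<beta> t"
proof -
  have "exp (- (2 * \<beta> * t)) * exp (2 * \<beta> * t) = 1"
    by (simp flip: exp_add)
  moreover have "1 + exp (2 * \<beta> * t) > 0" "1 + exp (- (2 * \<beta> * t)) > 0"
    by (simp_all add: add_pos_pos)
  ultimately show ?thesis
    by (simp add: sg_def field_simps)
qed

text \<open>Turns a product of step probabilities into the exponential of a sum, for bounds over
  arbitrarily many steps.\<close>

lemma sg_ge_exp: "exp (- exp (- (2 * \<beta> * t))) \<le> sg \<beta> t"
proof -
  have "1 + exp (- (2 * \<beta> * t)) \<le> exp (exp (- (2 * \<beta> * t)))"
    by (rule exp_ge_add_one_self)
  then show ?thesis
    by (simp add: sg_def exp_minus field_simps add_pos_pos)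
qed

lemma step_prob_right: "step_prob \<alpha> \<beta> p n 1 = sg \<beta> (pot \<alpha> p n (p n + 1) - pot \<alpha> p n (p n))"
proof -
  have "exp (b) / (exp b + exp (- b)) = 1 / (1 + exp (- (2 * b)))" for b :: real
  proof -
    have "exp (- b) = exp b * exp (- (2 * b))"
      by (simp flip: exp_add)
    then have "exp b + exp (- b) = exp b * (1 + exp (- (2 * b)))"
      by (simp add: algebra_simps)
    then show ?thesis by simp
  qed
  from this[of "\<beta> * Delta \<alpha> p n (p n)"] show ?thesis
    by (simp add: step_prob_def sg_def Delta_eq_pot Let_def mult.assoc)
qed

lemma step_prob_left: "step_prob \<alpha> \<beta> p n (-1) = sg \<beta> (pot \<alpha> p n (p n) - pot \<alpha> p n (p n + 1))"
proof -
  have "exp b + exp (- b) \<noteq> 0" for b :: real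
    using exp_gt_zero[of b] exp_gt_zero[of "- b"] by linarith
  then have "step_prob \<alpha> \<beta> p n (-1) = 1 - step_prob \<alpha> \<beta> p n 1"
    by (simp add: step_prob_def Let_def field_simps)
  then show ?thesis
    by (simp add: step_prob_right flip: sg_minus)
qed

lemma sg_eq_exp_mult: "sg \<beta> t = exp (2 * \<beta> * t) * sg \<beta> (- t)"
proof -
  have "exp (2 * \<beta> * t) * exp (- (2 * \<beta> * t)) = 1"
    by (simp flip: exp_add)
  moreover have "1 + exp (2 * \<beta> * t) > 0" "1 + exp (- (2 * \<beta> * t)) > 0"
    by (simp_all add: add_pos_pos)
  ultimately show ?thesis
    by (simp add: sg_def field_simps)
qed

lemma sg_le_exp: "sg \<beta> t \<le> exp (2 * \<beta> * t)"
  using mult_left_mono[OF sg_le_1[of \<beta> "- t"], of "exp (2 * \<beta> * t)"]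
  by (simp flip: sg_eq_exp_mult)

text \<open>Between edges with potentials \<open>b\<close> and \<open>c\<close>, the left side is
  the probability of crossing \<open>c\<close> and then the next edge \<open>d\<close>; the
  \<open>+ 1\<close> is there because the first crossing adds \<alpha> - 1 to \<open>c\<close> and
  \<alpha> to \<open>d\<close>. The exponents telescope, which removes \<open>c\<close>.\<close>

lemma sg_mult_le: "sg \<beta> (c - b) * sg \<beta> (d - c + 1) \<le> exp (2 * \<beta>) * exp (2 * \<beta> * (d - b)) * sg \<beta> (b - c)"
proof -
  have "sg \<beta> (c - b) * sg \<beta> (d - c + 1)
      \<le> (exp (2 * \<beta> * (c - b)) * sg \<beta> (b - c)) * exp (2 * \<beta> * (d - c + 1))"
    using sg_le_exp[of \<beta> "d - c + 1"] sg_eq_exp_mult[of \<beta> "c - b"]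
    by (intro mult_mono) (auto intro!: mult_nonneg_nonneg less_imp_le[OF sg_pos])
  also have "\<dots> = (exp (2 * \<beta> * (c - b)) * exp (2 * \<beta> * (d - c + 1))) * sg \<beta> (b - c)"
    by simp
  also have "exp (2 * \<beta> * (c - b)) * exp (2 * \<beta> * (d - c + 1)) = exp (2 * \<beta>) * exp (2 * \<beta> * (d - b))"
    by (simp add: algebra_simps flip: exp_add)
  finally show ?thesis .
qed

section \<open>Discrete processes\<close>

locale discrete_process = prob_space M for M :: "'w measure" +
  fixes X :: "nat \<Rightarrow> 'w \<Rightarrow> 'a :: countable"
  assumes X_meas [measurable]: "X i \<in> measurable M (count_space UNIV)"
begin

text \<open>The history is coded as a list so that it takes values in a countable type.\<close>

definition path :: "nat \<Rightarrow> 'w \<Rightarrow> 'a list" where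
  "path n \<omega> = map (\<lambda>i. X i \<omega>) [0..<Suc n]"

definition cyl :: "nat \<Rightarrow> (nat \<Rightarrow> 'a) \<Rightarrow> 'w set" where
  "cyl n p = {\<omega> \<in> space M. \<forall>i\<le>n. X i \<omega> = p i}"

definition fin_events :: "'w set set" where
  "fin_events = {{\<omega> \<in> space M. path n \<omega> \<in> S} | n S. True}"

definition adapted :: "(nat \<Rightarrow> (nat \<Rightarrow> 'a) \<Rightarrow> bool) \<Rightarrow> bool" where
  "adapted G \<longleftrightarrow> (\<forall>n p p'. (\<forall>i\<le>n. p i = p' i) \<longrightarrow> G n p = G n p')"

lemma path_eq_iff: "path n \<omega> = path n \<omega>' \<longleftrightarrow> (\<forall>i\<le>n. X i \<omega> = X i \<omega>')"
  by (auto simp: path_def map_eq_conv less_Suc_eq_le)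

lemma path_eq_list_iff: "path n \<omega> = l \<longleftrightarrow> length l = Suc n \<and> (\<forall>i\<le>n. X i \<omega> = l ! i)"
  by (auto simp: path_def list_eq_iff_nth_eq less_Suc_eq_le simp del: upt_Suc)

lemma path_measurable [measurable]: "path n \<in> measurable M (count_space UNIV)"
proof -
  have "path n -` {l} \<inter> space M \<in> sets M" for l
  proof -
    have "path n -` {l} \<inter> space M = {\<omega> \<in> space M. length l = Suc n \<and> (\<forall>i\<le>n. X i \<omega> = l ! i)}"
      by (rule set_eqI) (simp add: path_eq_list_iff conj_commute)
    also have "\<dots> \<in> sets M" by measurable
    finally show ?thesis .
  qed
  then show ?thesis
    by (simp add: measurable_count_space_eq2_countable)
qed

lemma cyl_sets [measurable]: "cyl n p \<in> sets M"
  unfolding cyl_def by measurable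

lemma fin_events_sets: "D \<in> fin_events \<Longrightarrow> D \<in> sets M"
  by (auto simp: fin_events_def)

lemma fin_eventI:
  assumes "\<And>\<omega> \<omega>'. (\<forall>i\<le>n. X i \<omega> = X i \<omega>') \<Longrightarrow> P \<omega> = P \<omega>'"
  shows "{\<omega> \<in> space M. P \<omega>} \<in> fin_events"
proof -
  have "{\<omega> \<in> space M. P \<omega>} = {\<omega> \<in> space M. path n \<omega> \<in> path n ` {\<omega> \<in> space M. P \<omega>}}"
    using assms by (auto simp: path_eq_iff image_iff)
  then show ?thesis
    unfolding fin_events_def by blast
qed

lemma fin_events_diff: "D \<in> fin_events \<Longrightarrow> space M - D \<in> fin_events"
proof -
  assume "D \<in> fin_events"
  then obtain n S where "D = {\<omega> \<in> space M. path n \<omega> \<in> S}"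
    by (auto simp: fin_events_def)
  then have "space M - D = {\<omega> \<in> space M. path n \<omega> \<in> - S}" by auto
  then show ?thesis unfolding fin_events_def by blast
qed

lemma fin_events_Un: "D \<in> fin_events \<Longrightarrow> E \<in> fin_events \<Longrightarrow> D \<union> E \<in> fin_events"
proof -
  assume "D \<in> fin_events" "E \<in> fin_events"
  then obtain n S m T where D: "D = {\<omega> \<in> space M. path n \<omega> \<in> S}"
    and E: "E = {\<omega> \<in> space M. path m \<omega> \<in> T}"
    by (auto simp: fin_events_def)
  have "path n \<omega> = path n \<omega>'" "path m \<omega> = path m \<omega>'"
    if "\<forall>i\<le>max n m. X i \<omega> = X i \<omega>'" for \<omega> \<omega>'
    using that by (auto simp: path_eq_iff)
  then have "{\<omega> \<in> space M. path n \<omega> \<in> S \<or> path m \<omega> \<in> T} \<in> fin_events"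
    by (intro fin_eventI[where n = "max n m"]) metis
  then show ?thesis
    by (simp add: D E Collect_disj_eq[symmetric] conj_disj_distribL Un_def)
qed

text \<open>These events form a sigma-algebra containing the finite-time events, so every event
  determined by the process is close to one decided at a finite time.\<close>

definition approximable :: "'w set \<Rightarrow> bool" where
  "approximable B \<longleftrightarrow> B \<in> sets M
     \<and> (\<forall>\<eta>>0. \<exists>D\<in>fin_events. prob (B - D) + prob (D - B) < \<eta>)"

lemma approximable_fin: "D \<in> fin_events \<Longrightarrow> approximable D"
  unfolding approximable_def using fin_events_sets by (auto intro!: bexI[of _ D])

lemma approximable_diff:
  assumes "approximable B"
  shows "approximable (space M - B)"
  unfolding approximable_def
proof (intro conjI allI impI)
  show "space M - B \<in> sets M" using assms by (auto simp: approximable_def)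
  fix \<eta> :: real assume "\<eta> > 0"
  then obtain D where D: "D \<in> fin_events" "prob (B - D) + prob (D - B) < \<eta>"
    using assms by (auto simp: approximable_def)
  have "B \<subseteq> space M" "D \<subseteq> space M"
    using assms fin_events_sets[OF D(1)] sets.sets_into_space by (auto simp: approximable_def)
  then have "(space M - B) - (space M - D) = D - B" "(space M - D) - (space M - B) = B - D"
    by auto
  with D show "\<exists>D\<in>fin_events. prob ((space M - B) - D) + prob (D - (space M - B)) < \<eta>"
    by (intro bexI[of _ "space M - D"]) (auto intro: fin_events_diff)
qed

lemma approximable_Un:
  assumes "approximable B" "approximable C"
  shows "approximable (B \<union> C)"
  unfolding approximable_def
proof (intro conjI allI impI)
  have [measurable]: "B \<in> sets M" "C \<in> sets M"
    using assms by (auto simp: approximable_def)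
  show "B \<union> C \<in> sets M" by simp
  fix \<eta> :: real assume "\<eta> > 0"
  then have "\<eta> / 2 > 0" by simp
  then obtain D E where D: "D \<in> fin_events" "prob (B - D) + prob (D - B) < \<eta> / 2"
    and E: "E \<in> fin_events" "prob (C - E) + prob (E - C) < \<eta> / 2"
    using assms unfolding approximable_def by meson
  have [measurable]: "D \<in> sets M" "E \<in> sets M"
    using D E by (auto intro: fin_events_sets)
  have "prob (B \<union> C - (D \<union> E)) \<le> prob ((B - D) \<union> (C - E))"
    by (rule finite_measure_mono) auto
  also have "\<dots> \<le> prob (B - D) + prob (C - E)"
    by (rule measure_Un_le) auto
  finally have 1: "prob (B \<union> C - (D \<union> E)) \<le> prob (B - D) + prob (C - E)" .
  have "prob (D \<union> E - (B \<union> C)) \<le> prob ((D - B) \<union> (E - C))"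
    by (rule finite_measure_mono) auto
  also have "\<dots> \<le> prob (D - B) + prob (E - C)"
    by (rule measure_Un_le) auto
  finally have "prob (D \<union> E - (B \<union> C)) \<le> prob (D - B) + prob (E - C)" .
  with 1 D E have "prob (B \<union> C - (D \<union> E)) + prob (D \<union> E - (B \<union> C)) < \<eta>" by linarith
  with fin_events_Un[OF D(1) E(1)]
  show "\<exists>D\<in>fin_events. prob (B \<union> C - D) + prob (D - (B \<union> C)) < \<eta>"
    by blast
qed

text \<open>By continuity from below a finite part of the union misses less than \<eta> / 2 of it;
  approximating that part costs the other half.\<close>

lemma approximable_UN:
  fixes B :: "nat \<Rightarrow> 'w set"
  assumes B: "\<And>i. approximable (B i)"
  shows "approximable (\<Union>i. B i)"
  unfolding approximable_def
proof (intro conjI allI impI)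
  have [measurable]: "\<And>i. B i \<in> sets M"
    using B by (auto simp: approximable_def)
  show "(\<Union>i. B i) \<in> sets M" by measurable
  fix \<eta> :: real assume "\<eta> > 0"
  let ?C = "\<lambda>n. \<Union>i\<le>n. B i"
  have C: "approximable (?C n)" for n
  proof (induction n)
    case 0
    then show ?case using B by simp
  next
    case (Suc n)
    then show ?case using approximable_Un[OF Suc B[of "Suc n"]] by (simp add: atMost_Suc Un_commute)
  qed
  have "(\<lambda>n. prob (?C n)) \<longlonglongrightarrow> prob (\<Union>n. ?C n)"
    by (rule finite_Lim_measure_incseq) (auto simp: incseq_def intro: order_trans)
  also have "(\<Union>n. ?C n) = (\<Union>i. B i)" by auto
  finally have "\<forall>\<^sub>F n in sequentially. \<bar>prob (?C n) - prob (\<Union>i. B i)\<bar> < \<eta> / 2"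
    using \<open>\<eta> > 0\<close> by (auto dest!: tendstoD[where e = "\<eta> / 2"] simp: dist_real_def)
  then obtain n where n: "\<bar>prob (?C n) - prob (\<Union>i. B i)\<bar> < \<eta> / 2"
    by (auto simp: eventually_sequentially)
  have "prob ((\<Union>i. B i) - ?C n) = prob (\<Union>i. B i) - prob (?C n)"
    by (rule finite_measure_Diff) auto
  with n have n': "prob ((\<Union>i. B i) - ?C n) < \<eta> / 2" by linarith
  obtain D where D: "D \<in> fin_events" "prob (?C n - D) + prob (D - ?C n) < \<eta> / 2"
    using C[of n] \<open>\<eta> > 0\<close> unfolding approximable_def by (meson half_gt_zero)
  have [measurable]: "D \<in> sets M"
    using D by (auto intro: fin_events_sets)
  have "prob ((\<Union>i. B i) - D) \<le> prob (((\<Union>i. B i) - ?C n) \<union> (?C n - D))"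
    by (rule finite_measure_mono) auto
  also have "\<dots> \<le> prob ((\<Union>i. B i) - ?C n) + prob (?C n - D)"
    by (rule measure_Un_le) auto
  finally have 1: "prob ((\<Union>i. B i) - D) \<le> prob ((\<Union>i. B i) - ?C n) + prob (?C n - D)" .
  have "prob (D - (\<Union>i. B i)) \<le> prob (D - ?C n)"
    by (rule finite_measure_mono) auto
  with 1 D n' have "prob ((\<Union>i. B i) - D) + prob (D - (\<Union>i. B i)) < \<eta>" by linarith
  with D(1) show "\<exists>D\<in>fin_events. prob ((\<Union>i. B i) - D) + prob (D - (\<Union>i. B i)) < \<eta>"
    by blast
qed

lemma approximable_sigma_sets: "B \<in> sigma_sets (space M) fin_events \<Longrightarrow> approximable B"
proof (induction rule: sigma_sets.induct)
  case Empty
  have "{\<omega> \<in> space M. False} \<in> fin_events" by (rule fin_eventI) simp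
  then show ?case using approximable_fin by simp
qed (auto intro: approximable_fin approximable_diff approximable_UN)

text \<open>The sigma-algebra generated by the process. Its events are approximable, whereas
  \<open>M\<close> may carry additional randomness.\<close>

definition gen :: "'w measure" where
  "gen = sigma (space M) fin_events"

lemma space_gen [simp]: "space gen = space M"
  by (simp add: gen_def space_measure_of_conv)

lemma sets_gen: "sets gen = sigma_sets (space M) fin_events"
  unfolding gen_def using fin_events_sets sets.sets_into_space
  by (intro sets_measure_of) auto

lemma adapted_gen:
  assumes "adapted G"
  shows "Measurable.pred gen (\<lambda>\<omega>. G n (\<lambda>i. X i \<omega>))"
proof -
  have "{\<omega> \<in> space M. G n (\<lambda>i. X i \<omega>)} \<in> fin_events"
    using assms by (intro fin_eventI[where n = n]) (auto simp: adapted_def)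
  then show ?thesis
    by (simp add: pred_def sets_gen)
qed

section \<open>Lower bounds on conditional probabilities\<close>

lemma prob_UN_lower_bound:
  fixes D :: "nat \<Rightarrow> 'w set"
  assumes [measurable]: "A \<in> sets M" "\<And>i. D i \<in> sets M" and disj: "disjoint_family D"
    and le: "\<And>i. c * prob (D i) \<le> prob (A \<inter> D i)"
  shows "c * prob (\<Union>i. D i) \<le> prob (A \<inter> (\<Union>i. D i))"
proof -
  have "(\<lambda>i. prob (D i)) sums prob (\<Union>i. D i)"
    by (rule finite_measure_UNION) (use disj in auto)
  then have 1: "(\<lambda>i. c * prob (D i)) sums (c * prob (\<Union>i. D i))"
    by (rule sums_mult)
  have 2: "(\<lambda>i. prob (A \<inter> D i)) sums prob (\<Union>i. A \<inter> D i)"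
    by (rule finite_measure_UNION) (use disj in \<open>auto simp: disjoint_family_on_def\<close>)
  have "(\<Union>i. A \<inter> D i) = A \<inter> (\<Union>i. D i)" by auto
  with sums_le[OF le 1 2] show ?thesis by simp
qed

text \<open>An event decided at time \<open>k\<close> is a countable disjoint union of cylinders,
  and the bounds on these add up.\<close>

lemma path_event_lower_bound:
  assumes [measurable]: "A \<in> sets M"
    and le: "\<And>p. P p \<Longrightarrow> c * prob (cyl k p) \<le> prob (A \<inter> cyl k p)"
    and P: "\<And>p p'. (\<forall>i\<le>k. p i = p' i) \<Longrightarrow> P p = P p'"
  shows "c * prob {\<omega> \<in> space M. P (\<lambda>i. X i \<omega>)} \<le> prob (A \<inter> {\<omega> \<in> space M. P (\<lambda>i. X i \<omega>)})"
proof -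
  \<comment> \<open>The index is the code of the history, so each nonempty \<open>D i\<close> is a
    single cylinder.\<close>
  define D where "D i = {\<omega> \<in> space M. P (\<lambda>i. X i \<omega>) \<and> to_nat (path k \<omega>) = i}" for i
  have "{\<omega> \<in> space M. P (\<lambda>i. X i \<omega>) \<and> to_nat (path k \<omega>) = i} \<in> fin_events" for i
  proof (rule fin_eventI[where n = k])
    fix \<omega> \<omega>' assume *: "\<forall>i\<le>k. X i \<omega> = X i \<omega>'"
    then have "path k \<omega> = path k \<omega>'" by (simp add: path_eq_iff)
    with P[OF *] show "(P (\<lambda>i. X i \<omega>) \<and> to_nat (path k \<omega>) = i)
        = (P (\<lambda>i. X i \<omega>') \<and> to_nat (path k \<omega>') = i)" by simp
  qed
  then have [measurable]: "D i \<in> sets M" for i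
    unfolding D_def using fin_events_sets by blast
  have disj: "disjoint_family D"
    by (auto simp: disjoint_family_on_def D_def)
  have "c * prob (D i) \<le> prob (A \<inter> D i)" for i
  proof (cases "D i = {}")
    case True
    then show ?thesis by simp
  next
    case False
    then obtain \<omega> where \<omega>: "\<omega> \<in> space M" "P (\<lambda>i. X i \<omega>)" "to_nat (path k \<omega>) = i"
      by (auto simp: D_def)
    have "D i = cyl k (\<lambda>i. X i \<omega>)"
    proof (intro set_eqI iffI)
      fix \<omega>' assume "\<omega>' \<in> D i"
      then have "path k \<omega>' = path k \<omega>" "\<omega>' \<in> space M"
        using \<omega> by (auto simp: D_def)
      then show "\<omega>' \<in> cyl k (\<lambda>i. X i \<omega>)"
        by (simp add: cyl_def path_eq_iff)
    next
      fix \<omega>' assume "\<omega>' \<in> cyl k (\<lambda>i. X i \<omega>)"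
      then have eq: "\<forall>i\<le>k. X i \<omega>' = X i \<omega>" and sp: "\<omega>' \<in> space M"
        by (auto simp: cyl_def)
      then have "path k \<omega>' = path k \<omega>" by (simp add: path_eq_iff)
      with P[OF eq] sp \<omega> show "\<omega>' \<in> D i" by (simp add: D_def)
    qed
    with le[OF \<omega>(2)] show ?thesis by simp
  qed
  then have "c * prob (\<Union>i. D i) \<le> prob (A \<inter> (\<Union>i. D i))"
    by (intro prob_UN_lower_bound disj) auto
  moreover have "(\<Union>i. D i) = {\<omega> \<in> space M. P (\<lambda>i. X i \<omega>)}"
    by (auto simp: D_def)
  ultimately show ?thesis by simp
qed

text \<open>A substitute for Levy's 0-1 law. If \<open>B\<close>, the event that \<open>G\<close> holds infinitely often and
  \<open>A\<close> fails, is close to a finite-time event \<open>C\<close>, then stopping at the first occurrence of \<open>G\<close> after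
  that time shows that \<open>A \<inter> C\<close>, which is almost disjoint from \<open>B\<close>, has probability at least
  \<open>\<epsilon> P(B \<inter> C)\<close>.\<close>
lemma AE_infinitely_often_imp:
  assumes A: "A \<in> sets gen" and G: "adapted G" and \<epsilon>: "\<epsilon> > 0"
    and le: "\<And>n p. G n p \<Longrightarrow> \<epsilon> * prob (cyl n p) \<le> prob (A \<inter> cyl n p)"
  shows "AE \<omega> in M. (\<exists>\<^sub>\<infinity>n. G n (\<lambda>i. X i \<omega>)) \<longrightarrow> \<omega> \<in> A"
proof -
  define B where "B = {\<omega> \<in> space M. (\<exists>\<^sub>\<infinity>n. G n (\<lambda>i. X i \<omega>)) \<and> \<omega> \<notin> A}"
  note [measurable] = A adapted_gen[OF G]
  have "{\<omega> \<in> space gen. (\<forall>n. \<exists>k\<ge>n. G k (\<lambda>i. X i \<omega>)) \<and> \<omega> \<notin> A} \<in> sets gen"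
    by measurable
  then have "approximable B"
    by (intro approximable_sigma_sets) (simp add: B_def INFM_nat_le sets_gen)
  have AM [measurable]: "A \<in> sets M"
    using A approximable_sigma_sets by (auto simp: sets_gen approximable_def)
  have BM [measurable]: "B \<in> sets M"
    using \<open>approximable B\<close> by (simp add: approximable_def)
  have bound: "\<epsilon> * (prob B - \<eta>) \<le> \<eta>" if "\<eta> > 0" for \<eta>
  proof -
    obtain C where C: "C \<in> fin_events" "prob (B - C) + prob (C - B) < \<eta>"
      using \<open>approximable B\<close> \<open>\<eta> > 0\<close> by (auto simp: approximable_def)
    then obtain n S where CS: "C = {\<omega> \<in> space M. path n \<omega> \<in> S}"
      by (auto simp: fin_events_def)
    have [measurable]: "C \<in> sets M" using C fin_events_sets by auto
    \<comment> \<open>\<open>P k\<close> makes \<open>k\<close> the first time from \<open>n\<close>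
      on at which \<open>G\<close> holds, inside \<open>C\<close>; the resulting events
      \<open>T k\<close> are disjoint and decided at time \<open>k\<close>.\<close>
    define P where "P k p \<longleftrightarrow> n \<le> k \<and> map p [0..<Suc n] \<in> S \<and> G k p \<and> (\<forall>i\<in>{n..<k}. \<not> G i p)"
      for k p
    define T where "T k = {\<omega> \<in> space M. P k (\<lambda>i. X i \<omega>)}" for k
    have Pcong: "P k p = P k p'" if "\<forall>i\<le>k. p i = p' i" for k p p'
    proof (cases "n \<le> k")
      case True
      have "G i p = G i p'" if "i \<le> k" for i
        using G \<open>\<forall>i\<le>k. p i = p' i\<close> that unfolding adapted_def by (meson order_trans)
      moreover have "map p [0..<Suc n] = map p' [0..<Suc n]"
        using that True by (intro map_cong) (auto simp: less_Suc_eq_le)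
      ultimately show ?thesis by (auto simp: P_def simp del: upt_Suc map_eq_conv)
    qed (simp add: P_def)
    have "T k \<in> fin_events" for k
      unfolding T_def by (rule fin_eventI[where n = k], rule Pcong) simp
    then have [measurable]: "T k \<in> sets M" for k
      by (rule fin_events_sets)
    have disj: "disjoint_family T"
    proof -
      have "T k \<inter> T l = {}" if "k < l" for k l
        using that by (auto simp: T_def P_def simp del: upt_Suc)
      then show ?thesis
        unfolding disjoint_family_on_def by (metis Int_commute linorder_neqE_nat)
    qed
    have "\<epsilon> * prob (T k) \<le> prob (A \<inter> T k)" for k
      unfolding T_def
    proof (rule path_event_lower_bound[where k = k, OF AM])
      show "\<epsilon> * prob (cyl k p) \<le> prob (A \<inter> cyl k p)" if "P k p" for p
        using that by (intro le) (simp add: P_def)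
    qed (rule Pcong)
    then have T: "\<epsilon> * prob (\<Union>k. T k) \<le> prob (A \<inter> (\<Union>k. T k))"
      by (intro prob_UN_lower_bound disj) auto
    have "B \<inter> C \<subseteq> (\<Union>k. T k)"
    proof
      fix \<omega> assume \<omega>: "\<omega> \<in> B \<inter> C"
      then have "\<exists>k\<ge>n. G k (\<lambda>i. X i \<omega>)"
        by (auto simp: B_def INFM_nat_le)
      then have *: "\<exists>k. n \<le> k \<and> G k (\<lambda>i. X i \<omega>)" by blast
      define k where "k = (LEAST k. n \<le> k \<and> G k (\<lambda>i. X i \<omega>))"
      have "n \<le> k \<and> G k (\<lambda>i. X i \<omega>)"
        unfolding k_def by (rule LeastI_ex[OF *])
      moreover have "\<not> G i (\<lambda>i. X i \<omega>)" if "i \<in> {n..<k}" for i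
        using that not_less_Least[of i "\<lambda>k. n \<le> k \<and> G k (\<lambda>i. X i \<omega>)"] unfolding k_def by auto
      ultimately have "P k (\<lambda>i. X i \<omega>)"
        using \<omega> by (auto simp: P_def CS path_def simp del: upt_Suc)
      with \<omega> show "\<omega> \<in> (\<Union>k. T k)" by (auto simp: T_def B_def)
    qed
    moreover have "(\<Union>k. T k) \<subseteq> C"
      by (auto simp: T_def P_def CS path_def simp del: upt_Suc)
    ultimately have BC: "prob (B \<inter> C) \<le> prob (\<Union>k. T k)" "prob (A \<inter> (\<Union>k. T k)) \<le> prob (C - B)"
    proof -
      assume sub: "B \<inter> C \<subseteq> (\<Union>k. T k)" "(\<Union>k. T k) \<subseteq> C"
      have "A \<inter> B = {}" by (auto simp: B_def)
      with sub have "A \<inter> (\<Union>k. T k) \<subseteq> C - B" by blast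
      then show "prob (A \<inter> (\<Union>k. T k)) \<le> prob (C - B)"
        by (rule finite_measure_mono) simp
      show "prob (B \<inter> C) \<le> prob (\<Union>k. T k)"
        using sub by (intro finite_measure_mono) simp_all
    qed
    have "prob B \<le> prob (B - C) + prob (B \<inter> C)"
    proof -
      have "B = (B - C) \<union> (B \<inter> C)" by auto
      then show ?thesis using measure_Un_le[of "B - C" M "B \<inter> C"] by simp
    qed
    then have "prob B - \<eta> \<le> prob (\<Union>k. T k)"
      using C BC measure_nonneg[of M "C - B"] by linarith
    then have "\<epsilon> * (prob B - \<eta>) \<le> \<epsilon> * prob (\<Union>k. T k)"
      using \<epsilon> by simp
    also have "\<dots> \<le> \<eta>"
      using T BC C measure_nonneg[of M "B - C"] by linarith
    finally show ?thesis .
  qed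
  have "prob B = 0"
  proof (rule ccontr)
    assume "prob B \<noteq> 0"
    then have pos: "prob B > 0" by (simp add: zero_less_measure_iff)
    \<comment> \<open>\<open>bound\<close> gives \<epsilon> P(B) \<le> (1 + \<epsilon>) \<eta>; this
      \<eta> makes the right side half of the left.\<close>
    define \<eta> where "\<eta> = \<epsilon> * prob B / (2 * (1 + \<epsilon>))"
    have "\<eta> > 0" using pos \<epsilon> by (simp add: \<eta>_def)
    from bound[OF this] have "\<epsilon> * prob B \<le> (1 + \<epsilon>) * \<eta>" by (simp add: algebra_simps)
    also have "\<dots> = \<epsilon> * prob B / 2" using \<epsilon> by (simp add: \<eta>_def field_simps)
    finally show False using pos \<epsilon> by simp
  qed
  then have "AE \<omega> in M. \<omega> \<notin> B"
    by (intro AE_not_in) (simp add: null_setsI emeasure_eq_measure)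
  then show ?thesis
    by (rule AE_mp) (rule AE_I2, unfold B_def, blast)
qed

end

section \<open>Round trips\<close>

text \<open>\<open>Q k a b c d\<close> stands for a lower bound \<open>k\<close> on the probability of getting stuck, for a walk
  whose four nearest edges have potentials \<open>a, b, c, d\<close> from left to right, or, after reflection,
  from right to left.\<close>
locale round_trips =
  fixes \<alpha> \<beta> K\<^sub>0 :: real and Q :: "real \<Rightarrow> real \<Rightarrow> real \<Rightarrow> real \<Rightarrow> real \<Rightarrow> bool"
  assumes \<beta>_pos: "\<beta> > 0" and \<alpha>_gt_1: "\<alpha> > 1"
    and weaken: "Q k a b c d \<Longrightarrow> k' \<le> k \<Longrightarrow> Q k' a b c d"
    and left_trip: "Q k (a + 2 * \<alpha>) (b + 2 * (\<alpha> - 1)) (c + 2 * \<alpha>) d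
      \<Longrightarrow> Q (sg \<beta> (b - c) * (sg \<beta> (b - a - 1) * k)) a b c d"
    and right_trip: "Q k a (b + 2 * \<alpha>) (c + 2 * (\<alpha> - 1)) (d + 2 * \<alpha>)
      \<Longrightarrow> Q (sg \<beta> (c - b) * (sg \<beta> (c - d - 1) * k)) a b c d"
    and final: "K\<^sub>0 \<le> b - d \<Longrightarrow> K\<^sub>0 \<le> c - a \<Longrightarrow> Q (1 / 2) a b c d"
begin

text \<open>A left trip followed by a right trip adds \<open>4 * \<alpha> - 2\<close> to
  \<open>b\<close> and \<open>c\<close> and \<open>2 * \<alpha>\<close> to \<open>a\<close> and
  \<open>d\<close>. So \<open>c - b\<close> is preserved while \<open>b - d\<close> and
  \<open>c - a\<close> each gain \<open>2 * (\<alpha> - 1)\<close>, and each of the four steps has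
  probability at least \<open>sg \<beta> (- (K + 1))\<close>. After \<open>j\<close> such rounds
  \<open>final\<close> applies.\<close>

lemma alternating_trips:
  assumes "K \<ge> 0" "b \<le> c" "c \<le> b + K" "a \<le> c" "d \<le> b + K"
    and "K\<^sub>0 \<le> b - d + 2 * (\<alpha> - 1) * real j" "K\<^sub>0 \<le> c - a + 2 * (\<alpha> - 1) * real j"
  shows "Q (sg \<beta> (- (K + 1)) ^ (4 * j) / 2) a b c d"
  using assms(2-)
proof (induction j arbitrary: a b c d)
  case 0
  then show ?case using final by simp
next
  case (Suc j)
  let ?\<gamma> = "\<alpha> - 1" and ?s = "sg \<beta> (- (K + 1))"
  let ?k = "?s ^ (4 * j) / 2"
  have "Q ?k (a + 2 * \<alpha>) (b + 2 * ?\<gamma> + 2 * \<alpha>) (c + 2 * \<alpha> + 2 * ?\<gamma>) (d + 2 * \<alpha>)"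
    using Suc.prems \<alpha>_gt_1 by (intro Suc.IH) (auto simp: algebra_simps)
  from left_trip[OF right_trip[OF this]]
  have Q: "Q (sg \<beta> (b - c) * (sg \<beta> (b - a - 1) *
      (sg \<beta> (c + 2 * \<alpha> - (b + 2 * ?\<gamma>)) * (sg \<beta> (c + 2 * \<alpha> - d - 1) * ?k)))) a b c d" .
  have "?s * (?s * (?s * (?s * ?k))) \<le> sg \<beta> (b - c) * (sg \<beta> (b - a - 1) *
      (sg \<beta> (c + 2 * \<alpha> - (b + 2 * ?\<gamma>)) * (sg \<beta> (c + 2 * \<alpha> - d - 1) * ?k)))"
    using Suc.prems \<alpha>_gt_1 \<beta>_pos \<open>K \<ge> 0\<close>
    by (intro mult_mono sg_mono mult_nonneg_nonneg order_refl) (auto intro: zero_le_power less_imp_le sg_pos)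
  also have "?s * (?s * (?s * (?s * ?k))) = ?s ^ (4 * Suc j) / 2"
    by (simp add: power_add numeral_eq_Suc)
  finally show ?case by (rule weaken[OF Q])
qed

lemma balanced:
  assumes "K \<ge> 0"
  obtains \<epsilon> where "\<epsilon> > 0"
    "\<And>a b c d. b \<le> c \<Longrightarrow> c \<le> b + K \<Longrightarrow> a \<le> c \<Longrightarrow> d \<le> b + K \<Longrightarrow> Q \<epsilon> a b c d"
proof -
  \<comment> \<open>Initially \<open>c - a\<close> is at least 0 and \<open>b - d\<close> at least
    \<open>- K\<close>, so a total gain of \<open>K\<^sub>0 + K\<close> suffices.\<close>
  obtain j :: nat where j: "(K\<^sub>0 + K) / (2 * (\<alpha> - 1)) \<le> real j"
    using real_arch_simple by blast
  then have "K\<^sub>0 + K \<le> 2 * (\<alpha> - 1) * real j"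
    using \<alpha>_gt_1 by (simp add: field_simps)
  then have "Q (sg \<beta> (- (K + 1)) ^ (4 * j) / 2) a b c d"
    if "b \<le> c" "c \<le> b + K" "a \<le> c" "d \<le> b + K" for a b c d
    using that assms by (intro alternating_trips) auto
  then show ?thesis
    by (rule that[rotated]) (simp_all add: sg_pos)
qed

text \<open>While \<open>b\<close> exceeds \<open>c\<close> the walk oscillates on the edge with potential \<open>b\<close>. Each oscillation
  multiplies \<open>\<rho> = exp (2 \<beta> (c - b))\<close> by \<open>exp (4 \<beta>)\<close>, so the failure probabilities, of order \<open>\<rho>\<close>, are
  summable uniformly in the starting value.\<close>
lemma stuck_lower_bound:
  assumes "K \<ge> 2"
  obtains \<epsilon> where "\<epsilon> > 0"
    "\<And>a b c d. c \<le> b + K \<Longrightarrow> a \<le> c \<Longrightarrow> d \<le> b + K \<Longrightarrow> Q \<epsilon> a b c d"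
proof -
  obtain \<epsilon> where \<epsilon>: "\<epsilon> > 0"
    and bal: "\<And>a b c d. b \<le> c \<Longrightarrow> c \<le> b + K \<Longrightarrow> a \<le> c \<Longrightarrow> d \<le> b + K \<Longrightarrow> Q \<epsilon> a b c d"
    using balanced[of K] assms by auto
  define q where "q = exp (2 * \<beta>)"
  \<comment> \<open>This \<open>s\<close> solves \<open>s * q\<^sup>2 = s + 1 + q\<close>. Hence the
    loss \<open>exp (- r - q * r)\<close> of a left trip, with \<open>r\<close> the current value of
    \<open>\<rho>\<close>, is exactly absorbed when \<open>\<rho>\<close> grows by the factor
    \<open>q\<^sup>2\<close>.\<close>
  define s where "s = 1 / (q - 1)"
  define \<rho> where "\<rho> b c = exp (2 * \<beta> * (c - b))" for b c
  have q: "q > 1" using \<beta>_pos by (simp add: q_def)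
  have s: "s > 0" using q by (simp add: s_def)
  have sq: "s * q\<^sup>2 = s + 1 + q"
    using q by (simp add: s_def field_simps power2_eq_square)
  \<comment> \<open>Each left trip lowers \<open>b - c\<close> by 2, and \<open>j\<close> bounds the
    number of trips. The condition \<open>c \<le> b + 2\<close> limits the overshoot, so that at the
    end \<open>bal\<close> applies and \<open>\<rho> b c\<close> is at most
    \<open>q\<^sup>2\<close>.\<close>
  have unbal: "Q (\<epsilon> * exp (s * (\<rho> b c - q\<^sup>2))) a b c d"
    if "b - c \<le> 2 * real j" "c \<le> b + 2" "a \<le> c" "d \<le> b + K" for j a b c d
    using that
  proof (induction j arbitrary: a b c d)
    case 0
    have "\<rho> b c \<le> exp (2 * \<beta> * 2)"
      unfolding \<rho>_def using 0 \<beta>_pos by (subst exp_le_cancel_iff) (intro mult_left_mono, auto)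
    also have "\<dots> = q\<^sup>2"
      by (simp add: q_def power2_eq_square flip: exp_add)
    finally have "\<epsilon> * exp (s * (\<rho> b c - q\<^sup>2)) \<le> \<epsilon>"
      using \<epsilon> s by (simp add: mult_le_cancel_left1 mult_le_0_iff)
    then show ?case
      using 0 assms by (intro weaken[OF bal[of b c a d]]) auto
  next
    case (Suc j)
    show ?case
    proof (cases "b - c \<le> 2 * real j")
      case True
      then show ?thesis using Suc by blast
    next
      case False
      define r where "r = \<rho> b c"
      have "Q (\<epsilon> * exp (s * (\<rho> (b + 2 * (\<alpha> - 1)) (c + 2 * \<alpha>) - q\<^sup>2)))
          (a + 2 * \<alpha>) (b + 2 * (\<alpha> - 1)) (c + 2 * \<alpha>) d"
        using Suc.prems False \<alpha>_gt_1 by (intro Suc.IH) (auto simp: algebra_simps)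
      moreover have "\<rho> (b + 2 * (\<alpha> - 1)) (c + 2 * \<alpha>) = q\<^sup>2 * r"
        by (simp add: \<rho>_def r_def q_def algebra_simps power2_eq_square flip: exp_add)
      ultimately have Q: "Q (sg \<beta> (b - c) * (sg \<beta> (b - a - 1) * (\<epsilon> * exp (s * (q\<^sup>2 * r - q\<^sup>2))))) a b c d"
        by (intro left_trip) simp
      have 1: "exp (- r) \<le> sg \<beta> (b - c)"
        using sg_ge_exp[of \<beta> "b - c"] by (simp add: r_def \<rho>_def algebra_simps)
      \<comment> \<open>On the way back the competing edge has potential \<open>a \<le> c\<close>;
        the extra 1 contributes the factor \<open>q\<close>.\<close>
      have "exp (- (q * r)) \<le> sg \<beta> (b - c - 1)"
        using sg_ge_exp[of \<beta> "b - c - 1"] by (simp add: r_def \<rho>_def q_def algebra_simps flip: exp_add)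
      also have "\<dots> \<le> sg \<beta> (b - a - 1)"
        using Suc.prems \<beta>_pos by (intro sg_mono) auto
      finally have 2: "exp (- (q * r)) \<le> sg \<beta> (b - a - 1)" .
      have "exp (- r) * (exp (- (q * r)) * (\<epsilon> * exp (s * (q\<^sup>2 * r - q\<^sup>2))))
        \<le> sg \<beta> (b - c) * (sg \<beta> (b - a - 1) * (\<epsilon> * exp (s * (q\<^sup>2 * r - q\<^sup>2))))"
        using 1 2 \<epsilon> by (intro mult_mono) (auto intro: less_imp_le sg_pos)
      also have "exp (- r) * (exp (- (q * r)) * (\<epsilon> * exp (s * (q\<^sup>2 * r - q\<^sup>2))))
        = \<epsilon> * exp (s * q\<^sup>2 * r - r - q * r - s * q\<^sup>2)"
        by (simp add: algebra_simps flip: exp_add)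
      also have "s * q\<^sup>2 * r - r - q * r - s * q\<^sup>2 = s * (r - q\<^sup>2)"
        by (subst (1) sq) (simp add: algebra_simps)
      finally show ?thesis
        unfolding r_def[symmetric] by (rule weaken[OF Q])
    qed
  qed
  have "Q (\<epsilon> * exp (- (s * q\<^sup>2))) a b c d" if *: "c \<le> b + K" "a \<le> c" "d \<le> b + K" for a b c d
  proof (cases "b \<le> c")
    case True
    have "\<epsilon> * exp (- (s * q\<^sup>2)) \<le> \<epsilon>"
      using \<epsilon> s by (simp add: mult_le_cancel_left1)
    then show ?thesis
      using bal[OF True *] weaken by blast
  next
    case False
    obtain j :: nat where "(b - c) / 2 \<le> real j"
      using real_arch_simple by blast
    then have "Q (\<epsilon> * exp (s * (\<rho> b c - q\<^sup>2))) a b c d"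
      using * False by (intro unbal[where j = j]) auto
    moreover have "- (s * q\<^sup>2) \<le> s * (\<rho> b c - q\<^sup>2)"
      using s by (simp add: algebra_simps \<rho>_def)
    then have "\<epsilon> * exp (- (s * q\<^sup>2)) \<le> \<epsilon> * exp (s * (\<rho> b c - q\<^sup>2))"
      using \<epsilon> by simp
    ultimately show ?thesis
      by (rule weaken)
  qed
  with \<epsilon> show ?thesis
    by (intro that[of "\<epsilon> * exp (- (s * q\<^sup>2))"]) simp_all
qed

end

section \<open>The walk\<close>

locale walk = prob_space M for M :: "'w measure" +
  fixes \<alpha> \<beta> :: real and X :: "nat \<Rightarrow> 'w \<Rightarrow> int"
  assumes \<beta>_pos: "\<beta> > 0" and \<alpha>_gt_1: "\<alpha> > 1" and walk: "is_walk M \<alpha> \<beta> X"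

sublocale walk \<subseteq> discrete_process M X
  using walk by unfold_locales (auto simp: is_walk_def)

context walk
begin

section \<open>One-step transitions on cylinders\<close>

lemma prob_cyl_Suc: "prob (cyl (Suc n) p) = prob (cyl n p) * trans_prob \<alpha> \<beta> p n (p (Suc n))"
  using walk by (simp add: is_walk_def cyl_def)

lemma cyl_upd: "cyl n (p(Suc n := y)) = cyl n p"
  by (auto simp: cyl_def)

lemma cyl_Suc_upd: "cyl (Suc n) (p(Suc n := y)) = {\<omega> \<in> cyl n p. X (Suc n) \<omega> = y}"
  by (auto simp: cyl_def le_Suc_eq)

lemma pot_upd: "pot \<alpha> (p(Suc n := y)) n = pot \<alpha> p n"
  by (rule pot_cong) simp

lemma prob_cyl_right:
  "prob (cyl (Suc n) (p(Suc n := p n + 1)))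
    = sg \<beta> (pot \<alpha> p n (p n + 1) - pot \<alpha> p n (p n)) * prob (cyl n p)"
  by (simp add: prob_cyl_Suc trans_prob_def step_prob_right cyl_upd pot_upd)

lemma prob_cyl_left:
  "prob (cyl (Suc n) (p(Suc n := p n - 1)))
    = sg \<beta> (pot \<alpha> p n (p n) - pot \<alpha> p n (p n + 1)) * prob (cyl n p)"
  by (simp add: prob_cyl_Suc trans_prob_def step_prob_left cyl_upd pot_upd)

lemma AE_nearest_neighbour: "AE \<omega> in M. \<forall>n. X (Suc n) \<omega> = X n \<omega> + 1 \<or> X (Suc n) \<omega> = X n \<omega> - 1"
proof -
  have "AE \<omega> in M. X (Suc n) \<omega> = X n \<omega> + 1 \<or> X (Suc n) \<omega> = X n \<omega> - 1" for n
  proof -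
    define P where "P p \<longleftrightarrow> \<not> (p (Suc n) = p n + 1 \<or> p (Suc n) = p n - 1)" for p :: "nat \<Rightarrow> int"
    \<comment> \<open>With the empty event as \<open>A\<close> this bounds the probability of a bad
      step by 0, since every cylinder containing such a step is null.\<close>
    have "1 * prob {\<omega> \<in> space M. P (\<lambda>i. X i \<omega>)} \<le> prob ({} \<inter> {\<omega> \<in> space M. P (\<lambda>i. X i \<omega>)})"
      by (rule path_event_lower_bound[where k = "Suc n"])
         (auto simp: P_def prob_cyl_Suc trans_prob_def)
    then have "prob {\<omega> \<in> space M. P (\<lambda>i. X i \<omega>)} = 0"
      by (simp add: measure_le_0_iff)
    moreover have "{\<omega> \<in> space M. P (\<lambda>i. X i \<omega>)} \<in> sets M"
      unfolding P_def by measurable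
    ultimately have "AE \<omega> in M. \<omega> \<notin> {\<omega> \<in> space M. P (\<lambda>i. X i \<omega>)}"
      by (intro AE_not_in) (simp add: null_setsI emeasure_eq_measure)
    then show ?thesis
      by (rule AE_mp) (auto simp: P_def intro!: AE_I2)
  qed
  then show ?thesis by (simp add: AE_all_countable)
qed

text \<open>A lower bound on the conditional probability of \<open>A\<close> given the history,
  multiplied out because cylinders may be null. It is uniform in time and history because site and
  potential together form a Markov chain.\<close>

definition lower :: "'w set \<Rightarrow> real \<Rightarrow> int \<Rightarrow> (int \<Rightarrow> real) \<Rightarrow> bool" where
  "lower A c x g \<longleftrightarrow>
    (\<forall>n p. p n = x \<longrightarrow> pot \<alpha> p n = g \<longrightarrow> c * prob (cyl n p) \<le> prob (A \<inter> cyl n p))"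

lemma lower_weaken: "lower A c x g \<Longrightarrow> c' \<le> c \<Longrightarrow> lower A c' x g"
  unfolding lower_def using mult_right_mono[of c' c "prob (cyl _ _)"]
  by (metis measure_nonneg order_trans)

lemma lower_right:
  assumes [measurable]: "A \<in> sets M" and lower: "lower A c (x + 1) (bump \<alpha> (x + 1) g)"
  shows "lower A (sg \<beta> (g (x + 1) - g x) * c) x g"
  unfolding lower_def
proof (intro allI impI)
  fix n p assume p: "p n = x" "pot \<alpha> p n = g"
  let ?p = "p(Suc n := p n + 1)"
  have "pot \<alpha> ?p (Suc n) = bump \<alpha> (x + 1) g"
    using p by (subst pot_Suc_right) (simp_all add: pot_upd)
  then have "c * prob (cyl (Suc n) ?p) \<le> prob (A \<inter> cyl (Suc n) ?p)"
    using lower p by (auto simp: lower_def)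
  also have "\<dots> \<le> prob (A \<inter> cyl n p)"
    by (rule finite_measure_mono) (auto simp: cyl_Suc_upd)
  finally show "sg \<beta> (g (x + 1) - g x) * c * prob (cyl n p) \<le> prob (A \<inter> cyl n p)"
    unfolding prob_cyl_right using p by (simp add: mult_ac)
qed

lemma lower_left:
  assumes [measurable]: "A \<in> sets M" and lower: "lower A c (x - 1) (bump \<alpha> x g)"
  shows "lower A (sg \<beta> (g x - g (x + 1)) * c) x g"
  unfolding lower_def
proof (intro allI impI)
  fix n p assume p: "p n = x" "pot \<alpha> p n = g"
  let ?p = "p(Suc n := p n - 1)"
  have "pot \<alpha> ?p (Suc n) = bump \<alpha> x g"
    using p by (subst pot_Suc_left) (simp_all add: pot_upd)
  then have "c * prob (cyl (Suc n) ?p) \<le> prob (A \<inter> cyl (Suc n) ?p)"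
    using lower p by (auto simp: lower_def)
  also have "\<dots> \<le> prob (A \<inter> cyl n p)"
    by (rule finite_measure_mono) (auto simp: cyl_Suc_upd)
  finally show "sg \<beta> (g x - g (x + 1)) * c * prob (cyl n p) \<le> prob (A \<inter> cyl n p)"
    unfolding prob_cyl_left using p by (simp add: mult_ac)
qed

subsection \<open>Exit from three sites\<close>

definition exits :: "int \<Rightarrow> nat \<Rightarrow> nat \<Rightarrow> 'w set" where
  "exits z n N = {\<omega> \<in> space M. \<exists>m\<in>{n..n + N}. X m \<omega> \<notin> {z - 1, z, z + 1}}"

lemma exits_sets [measurable]: "exits z n N \<in> sets M"
  unfolding exits_def by (rule fin_events_sets, rule fin_eventI[where n = "n + N"]) simp

definition upper :: "int \<Rightarrow> nat \<Rightarrow> real \<Rightarrow> int \<Rightarrow> (int \<Rightarrow> real) \<Rightarrow> bool" where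
  "upper z N c x g \<longleftrightarrow>
    (\<forall>n p. p n = x \<longrightarrow> pot \<alpha> p n = g \<longrightarrow> prob (cyl n p \<inter> exits z n N) \<le> c * prob (cyl n p))"

lemma upper_weaken: "upper z N c x g \<Longrightarrow> c \<le> c' \<Longrightarrow> upper z N c' x g"
  unfolding upper_def using mult_right_mono[of c c' "prob (cyl _ _)"]
  by (metis measure_nonneg order_trans)

lemma upper_1: "upper z N 1 x g"
  unfolding upper_def by (auto intro: finite_measure_mono)

lemma upper_0: "x \<in> {z - 1, z, z + 1} \<Longrightarrow> 0 \<le> c \<Longrightarrow> upper z 0 c x g"
proof -
  assume x: "x \<in> {z - 1, z, z + 1}" "0 \<le> c"
  then have "cyl n p \<inter> exits z n 0 = {}" if "p n = x" for n p
    using that by (auto simp: cyl_def exits_def)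
  then show ?thesis
    using x by (auto simp: upper_def)
qed

text \<open>An exit cannot happen at the current time, as \<open>x\<close> is one of the three
  sites, and almost surely the cylinder splits into the two for the next step.\<close>

lemma upper_Suc:
  assumes x: "x \<in> {z - 1, z, z + 1}"
    and right: "upper z N c\<^sub>r (x + 1) (bump \<alpha> (x + 1) g)"
    and left: "upper z N c\<^sub>l (x - 1) (bump \<alpha> x g)"
  shows "upper z (Suc N) (sg \<beta> (g (x + 1) - g x) * c\<^sub>r + sg \<beta> (g x - g (x + 1)) * c\<^sub>l) x g"
  unfolding upper_def
proof (intro allI impI)
  fix n p assume p: "p n = x" "pot \<alpha> p n = g"
  let ?r = "p(Suc n := p n + 1)" and ?l = "p(Suc n := p n - 1)"
  have "pot \<alpha> ?r (Suc n) = bump \<alpha> (x + 1) g" "pot \<alpha> ?l (Suc n) = bump \<alpha> x g"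
    using p by (subst pot_Suc_right pot_Suc_left; simp add: pot_upd)+
  then have r: "prob (cyl (Suc n) ?r \<inter> exits z (Suc n) N) \<le> c\<^sub>r * prob (cyl (Suc n) ?r)"
    and l: "prob (cyl (Suc n) ?l \<inter> exits z (Suc n) N) \<le> c\<^sub>l * prob (cyl (Suc n) ?l)"
    using left right p by (auto simp: upper_def)
  have "prob (cyl n p \<inter> exits z n (Suc N))
      \<le> prob ((cyl (Suc n) ?r \<inter> exits z (Suc n) N) \<union> (cyl (Suc n) ?l \<inter> exits z (Suc n) N))"
  proof (rule finite_measure_mono_AE)
    show "AE \<omega> in M. \<omega> \<in> cyl n p \<inter> exits z n (Suc N) \<longrightarrow>
        \<omega> \<in> (cyl (Suc n) ?r \<inter> exits z (Suc n) N) \<union> (cyl (Suc n) ?l \<inter> exits z (Suc n) N)"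
      using AE_nearest_neighbour
    proof eventually_elim
      case (elim \<omega>)
      show ?case
      proof
        assume \<omega>: "\<omega> \<in> cyl n p \<inter> exits z n (Suc N)"
        then have Xn: "X n \<omega> = p n" by (simp add: cyl_def)
        obtain m where m: "m \<in> {n..n + Suc N}" "X m \<omega> \<notin> {z - 1, z, z + 1}"
          using \<omega> by (auto simp: exits_def)
        with Xn x p have "m \<noteq> n" by auto
        with m have "m \<in> {Suc n..Suc n + N}" by auto
        with m \<omega> have "\<omega> \<in> exits z (Suc n) N"
          unfolding exits_def by blast
        with \<omega> elim[rule_format, of n] Xn
        show "\<omega> \<in> (cyl (Suc n) ?r \<inter> exits z (Suc n) N) \<union> (cyl (Suc n) ?l \<inter> exits z (Suc n) N)"
          by (auto simp: cyl_Suc_upd)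
      qed
    qed
  qed simp
  also have "\<dots> \<le> prob (cyl (Suc n) ?r \<inter> exits z (Suc n) N) + prob (cyl (Suc n) ?l \<inter> exits z (Suc n) N)"
    by (rule measure_Un_le) simp_all
  also have "\<dots> \<le> c\<^sub>r * prob (cyl (Suc n) ?r) + c\<^sub>l * prob (cyl (Suc n) ?l)"
    using r l by simp
  finally show "prob (cyl n p \<inter> exits z n (Suc N))
      \<le> (sg \<beta> (g (x + 1) - g x) * c\<^sub>r + sg \<beta> (g x - g (x + 1)) * c\<^sub>l) * prob (cyl n p)"
    unfolding prob_cyl_left prob_cyl_right using p by (simp add: algebra_simps)
qed

text \<open>A round trip over an edge at the middle site adds \<open>2 * (\<alpha> - 1)\<close> to
  its potential and so shrinks the term of \<open>esc\<close> belonging to it by this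
  factor.\<close>

definition \<kappa> :: real where
  "\<kappa> = exp (- (4 * \<beta> * (\<alpha> - 1)))"

text \<open>Chosen so that the gain \<open>1 - \<kappa>\<close> of a trip pays for the factor
  \<open>exp (2 * \<beta>)\<close> in \<open>sg_mult_le\<close>.\<close>

definition esc_const :: real where
  "esc_const = exp (2 * \<beta>) / (1 - \<kappa>)"

definition esc :: "real \<Rightarrow> real \<Rightarrow> real \<Rightarrow> real \<Rightarrow> real" where
  "esc a b c d = esc_const * (exp (2 * \<beta> * (d - b)) + exp (2 * \<beta> * (a - c)))"

lemma \<kappa>: "0 < \<kappa>" "\<kappa> < 1"
  using \<alpha>_gt_1 \<beta>_pos by (simp_all add: \<kappa>_def)

lemma esc_const: "0 < esc_const" "esc_const * (1 - \<kappa>) = exp (2 * \<beta>)"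
  using \<kappa> by (simp_all add: esc_const_def)

lemma esc_nonneg: "0 \<le> esc a b c d"
  using esc_const by (simp add: esc_def add_nonneg_nonneg)

text \<open>\<open>a\<close> and \<open>c\<close> rise equally, so their term is unchanged and only
  the one with \<open>b\<close> shrinks.\<close>

lemma esc_left_trip:
  "esc (a + 2 * \<alpha>) (b + 2 * (\<alpha> - 1)) (c + 2 * \<alpha>) d
    = esc_const * (\<kappa> * exp (2 * \<beta> * (d - b)) + exp (2 * \<beta> * (a - c)))"
proof -
  have "exp (2 * \<beta> * (d - (b + 2 * (\<alpha> - 1)))) = \<kappa> * exp (2 * \<beta> * (d - b))"
    unfolding \<kappa>_def by (simp add: algebra_simps flip: exp_add)
  then show ?thesis by (simp add: esc_def)
qed

lemma esc_right_trip:
  "esc a (b + 2 * \<alpha>) (c + 2 * (\<alpha> - 1)) (d + 2 * \<alpha>)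
    = esc_const * (exp (2 * \<beta> * (d - b)) + \<kappa> * exp (2 * \<beta> * (a - c)))"
proof -
  have "exp (2 * \<beta> * (a - (c + 2 * (\<alpha> - 1)))) = \<kappa> * exp (2 * \<beta> * (a - c))"
    unfolding \<kappa>_def by (simp add: algebra_simps flip: exp_add)
  then show ?thesis by (simp add: esc_def)
qed

text \<open>The loss from a possible exit on a right trip is compensated by the gain \<open>1 - \<kappa>\<close> of a left
  trip, because \<open>sg (c - b) sg (d - c + 1)\<close> is at most \<open>sg (b - c)\<close> times
  \<open>exp (2 \<beta>) exp (2 \<beta> (d - b))\<close>.\<close>
lemma esc_supermartingale:
  "sg \<beta> (c - b) * (sg \<beta> (d - c + 1) * 1
      + sg \<beta> (c - d - 1) * esc a (b + 2 * \<alpha>) (c + 2 * (\<alpha> - 1)) (d + 2 * \<alpha>))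
    + sg \<beta> (b - c) * (sg \<beta> (b - a - 1) * esc (a + 2 * \<alpha>) (b + 2 * (\<alpha> - 1)) (c + 2 * \<alpha>) d
      + sg \<beta> (a - b + 1) * 1) \<le> esc a b c d"
proof -
  define r l C q where "r = exp (2 * \<beta> * (d - b))" and "l = exp (2 * \<beta> * (a - c))"
    and "C = esc_const" and "q = exp (2 * \<beta>)"
  define P P' where "P = sg \<beta> (c - b)" and "P' = sg \<beta> (b - c)"
  have PP': "P' = 1 - P"
    using sg_minus[of \<beta> "c - b"] by (simp add: P_def P'_def)
  have P: "0 \<le> P" "0 \<le> P'"
    by (simp_all add: P_def P'_def less_imp_le sg_pos)
  have C: "0 < C" "q = C * (1 - \<kappa>)"
    using esc_const by (simp_all add: C_def q_def)
  have rl: "0 < r" "0 < l" by (simp_all add: r_def l_def)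
  have u: "P * sg \<beta> (d - c + 1) \<le> q * r * P'"
    using sg_mult_le[of \<beta> c b d] by (simp add: P_def P'_def q_def r_def)
  have v: "P' * sg \<beta> (a - b + 1) \<le> q * l * P"
    using sg_mult_le[of \<beta> b c a] by (simp add: P_def P'_def q_def l_def)
  have "P * (sg \<beta> (c - d - 1) * (C * (r + \<kappa> * l))) \<le> P * (1 * (C * (r + \<kappa> * l)))"
    using P C rl \<kappa> sg_le_1 by (intro mult_left_mono mult_right_mono) auto
  moreover have "P' * (sg \<beta> (b - a - 1) * (C * (\<kappa> * r + l))) \<le> P' * (1 * (C * (\<kappa> * r + l)))"
    using P C rl \<kappa> sg_le_1 by (intro mult_left_mono mult_right_mono) auto
  \<comment> \<open>The exit terms are replaced by their bounds \<open>u\<close> and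
    \<open>v\<close>; the total is then an identity because \<open>P + P' = 1\<close>.\<close>
  moreover have "q * r * P' + P * (C * (r + \<kappa> * l)) + (q * l * P + P' * (C * (\<kappa> * r + l))) = C * (r + l)"
    unfolding C(2) PP' by (simp add: algebra_simps)
  ultimately have "P * (sg \<beta> (d - c + 1) * 1 + sg \<beta> (c - d - 1) * (C * (r + \<kappa> * l)))
    + P' * (sg \<beta> (b - a - 1) * (C * (\<kappa> * r + l)) + sg \<beta> (a - b + 1) * 1) \<le> C * (r + l)"
    using u v by (simp add: distrib_left)
  then show ?thesis
    unfolding esc_left_trip esc_right_trip
    by (simp add: esc_def r_def l_def C_def P_def P'_def)
qed

text \<open>Induction in steps of two: from \<open>z\<close> the walk moves to a neighbour and then
  either exits, which is bounded by 1, or is back at \<open>z\<close>, where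
  \<open>esc_supermartingale\<close> closes the recursion.\<close>

lemma upper_esc: "upper z N (esc (g (z - 1)) (g z) (g (z + 1)) (g (z + 2))) z g"
proof (induction N arbitrary: g rule: induct_nat_012)
  case 0
  show ?case by (rule upper_0) (auto simp: esc_nonneg)
next
  case 1
  have "upper z (Suc 0) (sg \<beta> (g (z + 1) - g z) * 0 + sg \<beta> (g z - g (z + 1)) * 0) z g"
    by (intro upper_Suc upper_0) auto
  then show ?case
    by (rule upper_weaken) (simp add: esc_nonneg)
next
  case (ge2 N)
  let ?e = "\<lambda>g. esc (g (z - 1)) (g z) (g (z + 1)) (g (z + 2))"
  let ?r = "bump \<alpha> (z + 1) g" and ?l = "bump \<alpha> z g"
  have 1: "upper z (Suc N) (sg \<beta> (?r (z + 2) - ?r (z + 1)) * 1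
      + sg \<beta> (?r (z + 1) - ?r (z + 2)) * ?e (bump \<alpha> (z + 1) ?r)) (z + 1) ?r"
    using upper_Suc[of "z + 1" z N 1 ?r "?e (bump \<alpha> (z + 1) ?r)"] upper_1 ge2(1)
    by (simp add: add.commute)
  have 2: "upper z (Suc N) (sg \<beta> (?l z - ?l (z - 1)) * ?e (bump \<alpha> z ?l)
      + sg \<beta> (?l (z - 1) - ?l z) * 1) (z - 1) ?l"
    using upper_Suc[of "z - 1" z N "?e (bump \<alpha> z ?l)" ?l 1] upper_1 ge2(1)
    by (simp add: add.commute)
  show ?case
    using esc_supermartingale[of "g (z + 1)" "g z" "g (z + 2)" "g (z - 1)"]
    by (intro upper_weaken[OF upper_Suc[OF _ 1 2]]) (simp_all add: bump_def algebra_simps)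
qed

subsection \<open>Getting stuck\<close>

definition stuck :: "'w set" where
  "stuck = {\<omega> \<in> space M. \<exists>z n. \<forall>m\<ge>n. X m \<omega> \<in> {z - 1, z, z + 1}}"

lemma pred_gen_X: "Measurable.pred gen (\<lambda>\<omega>. X m \<omega> \<in> S)"
proof -
  have "{\<omega> \<in> space M. X m \<omega> \<in> S} \<in> fin_events"
    by (rule fin_eventI[where n = m]) simp
  then show ?thesis by (simp add: pred_def sets_gen)
qed

lemma stuck_gen: "stuck \<in> sets gen"
proof -
  note pred_gen_X [measurable]
  have "{\<omega> \<in> space gen. \<exists>z n. \<forall>m\<ge>n. X m \<omega> \<in> {z - 1, z, z + 1}} \<in> sets gen"
    by measurable
  then show ?thesis unfolding stuck_def space_gen .
qed

lemma gen_sets: "A \<in> sets gen \<Longrightarrow> A \<in> sets M"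
  using approximable_sigma_sets by (auto simp: sets_gen approximable_def)

lemma stuck_sets [measurable]: "stuck \<in> sets M"
  by (rule gen_sets[OF stuck_gen])

text \<open>The exit bound does not depend on the horizon, so it survives the limit; a path that
  never exits is stuck.\<close>

lemma lower_stuck_esc:
  assumes "esc (g (z - 1)) (g z) (g (z + 1)) (g (z + 2)) \<le> 1 / 2"
  shows "lower stuck (1 / 2) z g"
  unfolding lower_def
proof (intro allI impI)
  fix n p assume p: "p n = z" "pot \<alpha> p n = g"
  let ?E = "\<lambda>N. cyl n p \<inter> exits z n N"
  have "prob (?E N) \<le> 1 / 2 * prob (cyl n p)" for N
    using upper_weaken[OF upper_esc assms] p by (auto simp: upper_def)
  moreover have "(\<lambda>N. prob (?E N)) \<longlonglongrightarrow> prob (\<Union>N. ?E N)"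
    by (rule finite_Lim_measure_incseq) (auto simp: incseq_def exits_def; force)+
  ultimately have "prob (\<Union>N. ?E N) \<le> 1 / 2 * prob (cyl n p)"
    by (intro LIMSEQ_le_const2) auto
  moreover have "prob (cyl n p - (\<Union>N. ?E N)) = prob (cyl n p) - prob (\<Union>N. ?E N)"
    by (rule finite_measure_Diff) auto
  moreover have "cyl n p - (\<Union>N. ?E N) \<subseteq> stuck \<inter> cyl n p"
  proof
    fix \<omega> assume \<omega>: "\<omega> \<in> cyl n p - (\<Union>N. ?E N)"
    have "X m \<omega> \<in> {z - 1, z, z + 1}" if "m \<ge> n" for m
    proof (rule ccontr)
      assume "X m \<omega> \<notin> {z - 1, z, z + 1}"
      moreover have "m \<in> {n..n + (m - n)}" using that by simp
      ultimately have "\<omega> \<in> exits z n (m - n)"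
        using \<omega> unfolding exits_def cyl_def by blast
      with \<omega> show False by blast
    qed
    with \<omega> show "\<omega> \<in> stuck \<inter> cyl n p"
      unfolding stuck_def cyl_def by blast
  qed
  then have "prob (cyl n p - (\<Union>N. ?E N)) \<le> prob (stuck \<inter> cyl n p)"
    by (rule finite_measure_mono) simp
  ultimately show "1 / 2 * prob (cyl n p) \<le> prob (stuck \<inter> cyl n p)"
    by linarith
qed

text \<open>Chosen so that each of the two terms of \<open>esc\<close> is at most 1/4.\<close>

definition gap :: real where
  "gap = ln (4 * esc_const) / (2 * \<beta>)"

lemma lower_stuck_gap:
  assumes "gap \<le> g z - g (z + 2)" "gap \<le> g (z + 1) - g (z - 1)"
  shows "lower stuck (1 / 2) z g"
proof (rule lower_stuck_esc)
  have small: "esc_const * exp (2 * \<beta> * t) \<le> 1 / 4" if "gap \<le> - t" for t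
  proof -
    have "ln (4 * esc_const) \<le> 2 * \<beta> * (- t)"
      using that \<beta>_pos by (simp add: gap_def field_simps)
    then have "exp (ln (4 * esc_const)) \<le> exp (2 * \<beta> * (- t))"
      by (simp only: exp_le_cancel_iff)
    then have "4 * esc_const \<le> exp (2 * \<beta> * (- t))"
      using esc_const(1) by simp
    then show ?thesis
      by (simp add: exp_minus field_simps)
  qed
  show "esc (g (z - 1)) (g z) (g (z + 1)) (g (z + 2)) \<le> 1 / 2"
    using small[of "g (z + 2) - g z"] small[of "g (z - 1) - g (z + 1)"] assms
    by (simp add: esc_def distrib_left)
qed

text \<open>Reduces the configuration to the potentials of the four edges nearest to
  \<open>z\<close>, so that round trips become a recursion on four reals.\<close>

definition lower_at :: "real \<Rightarrow> real \<Rightarrow> real \<Rightarrow> real \<Rightarrow> real \<Rightarrow> bool" where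
  "lower_at k a b c d \<longleftrightarrow>
    (\<forall>z g. g (z - 1) = a \<longrightarrow> g z = b \<longrightarrow> g (z + 1) = c \<longrightarrow> g (z + 2) = d \<longrightarrow> lower stuck k z g)"

lemma lower_atD: "lower_at k (g (z - 1)) (g z) (g (z + 1)) (g (z + 2)) \<Longrightarrow> lower stuck k z g"
  by (auto simp: lower_at_def)

text \<open>Two steps, across edge \<open>b\<close> and back. The \<open>- 1\<close> in the second
  factor arises because the first crossing adds \<alpha> - 1 to \<open>b\<close> and \<alpha> to
  \<open>a\<close>.\<close>

lemma lower_at_left_trip:
  assumes "lower_at k (a + 2 * \<alpha>) (b + 2 * (\<alpha> - 1)) (c + 2 * \<alpha>) d"
  shows "lower_at (sg \<beta> (b - c) * (sg \<beta> (b - a - 1) * k)) a b c d"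
  unfolding lower_at_def
proof (intro allI impI)
  fix z :: int and g :: "int \<Rightarrow> real"
  assume g: "g (z - 1) = a" "g z = b" "g (z + 1) = c" "g (z + 2) = d"
  let ?g = "bump \<alpha> z g"
  have "lower stuck k (z - 1 + 1) (bump \<alpha> (z - 1 + 1) ?g)"
    using assms g by (auto simp: lower_at_def bump_def)
  from lower_right[OF stuck_sets this]
  have "lower stuck (sg \<beta> (b - a - 1) * k) (z - 1) ?g"
    using g by (simp add: bump_def algebra_simps)
  from lower_left[OF stuck_sets this]
  show "lower stuck (sg \<beta> (b - c) * (sg \<beta> (b - a - 1) * k)) z g"
    using g by simp
qed

lemma lower_at_right_trip:
  assumes "lower_at k a (b + 2 * \<alpha>) (c + 2 * (\<alpha> - 1)) (d + 2 * \<alpha>)"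
  shows "lower_at (sg \<beta> (c - b) * (sg \<beta> (c - d - 1) * k)) a b c d"
  unfolding lower_at_def
proof (intro allI impI)
  fix z :: int and g :: "int \<Rightarrow> real"
  assume g: "g (z - 1) = a" "g z = b" "g (z + 1) = c" "g (z + 2) = d"
  let ?g = "bump \<alpha> (z + 1) g"
  have "lower stuck k (z + 1 - 1) (bump \<alpha> (z + 1) ?g)"
    using assms g by (auto simp: lower_at_def bump_def)
  from lower_left[OF stuck_sets this]
  have "lower stuck (sg \<beta> (c - d - 1) * k) (z + 1) ?g"
    using g by (simp add: bump_def algebra_simps)
  from lower_right[OF stuck_sets this]
  show "lower stuck (sg \<beta> (c - b) * (sg \<beta> (c - d - 1) * k)) z g"
    using g by simp
qed

lemma lower_at_weaken:
  assumes "lower_at k a b c d" "k' \<le> k"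
  shows "lower_at k' a b c d"
  using assms(1) lower_weaken[OF _ assms(2)] unfolding lower_at_def by simp

lemma lower_at_gap: "gap \<le> b - d \<Longrightarrow> gap \<le> c - a \<Longrightarrow> lower_at (1 / 2) a b c d"
  unfolding lower_at_def by (auto intro!: lower_stuck_gap)

lemma round_trips_right: "round_trips \<alpha> \<beta> gap lower_at"
proof (rule round_trips.intro)
qed (rule \<beta>_pos \<alpha>_gt_1 | erule lower_at_left_trip lower_at_right_trip
    | rule lower_at_gap lower_at_weaken, assumption, assumption)+

text \<open>Reflection: reversing the four potentials exchanges left and right trips.\<close>

lemma round_trips_left: "round_trips \<alpha> \<beta> gap (\<lambda>k a b c d. lower_at k d c b a)"
proof (rule round_trips.intro)
qed (rule \<beta>_pos \<alpha>_gt_1 | erule lower_at_left_trip lower_at_right_trip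
    | rule lower_at_gap lower_at_weaken, assumption, assumption)+

text \<open>If the other edge at \<open>x\<close> is at least as heavy as the far neighbour of
  \<open>e\<close>, then \<open>x\<close> can serve as middle site. Otherwise one step over
  \<open>e\<close> leads to a site that can.\<close>

lemma lower_stuck_near_max:
  obtains \<epsilon> where "\<epsilon> > 0"
    "\<And>x g e. e \<in> {x, x + 1} \<Longrightarrow> (\<And>e'. g e' \<le> g e + \<alpha>) \<Longrightarrow> lower stuck \<epsilon> x g"
proof -
  \<comment> \<open>The extra step over \<open>e\<close> raises its neighbours by one more than
    \<open>e\<close> itself, hence \<alpha> + 1 instead of \<alpha>.\<close>
  have K: "2 \<le> \<alpha> + 1" using \<alpha>_gt_1 by simp
  obtain \<epsilon>\<^sub>1 where \<epsilon>\<^sub>1: "\<epsilon>\<^sub>1 > 0"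
    and right: "\<And>a b c d. c \<le> b + (\<alpha> + 1) \<Longrightarrow> a \<le> c \<Longrightarrow> d \<le> b + (\<alpha> + 1) \<Longrightarrow> lower_at \<epsilon>\<^sub>1 a b c d"
    using round_trips.stuck_lower_bound[OF round_trips_right K] by blast
  obtain \<epsilon>\<^sub>2 where \<epsilon>\<^sub>2: "\<epsilon>\<^sub>2 > 0"
    and left: "\<And>a b c d. c \<le> b + (\<alpha> + 1) \<Longrightarrow> a \<le> c \<Longrightarrow> d \<le> b + (\<alpha> + 1) \<Longrightarrow> lower_at \<epsilon>\<^sub>2 d c b a"
    using round_trips.stuck_lower_bound[OF round_trips_left K] by blast
  \<comment> \<open>Bounds the probability of the extra step from below: the competing edge exceeds
    \<open>e\<close> by at most \<alpha>.\<close>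
  define \<delta> where "\<delta> = sg \<beta> (- \<alpha>)"
  define \<epsilon> where "\<epsilon> = \<delta> * min \<epsilon>\<^sub>1 \<epsilon>\<^sub>2"
  have \<delta>: "0 < \<delta>" "\<delta> \<le> 1" by (simp_all add: \<delta>_def sg_pos sg_le_1)
  have \<epsilon>: "\<epsilon> > 0" "\<epsilon> \<le> \<epsilon>\<^sub>1" "\<epsilon> \<le> \<epsilon>\<^sub>2" "\<epsilon> \<le> \<delta> * \<epsilon>\<^sub>1" "\<epsilon> \<le> \<delta> * \<epsilon>\<^sub>2"
  proof -
    show "\<epsilon> > 0" using \<delta> \<epsilon>\<^sub>1 \<epsilon>\<^sub>2 by (simp add: \<epsilon>_def)
    have "\<epsilon> \<le> 1 * min \<epsilon>\<^sub>1 \<epsilon>\<^sub>2"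
      unfolding \<epsilon>_def using \<delta> \<epsilon>\<^sub>1 \<epsilon>\<^sub>2 by (intro mult_right_mono) auto
    then show "\<epsilon> \<le> \<epsilon>\<^sub>1" "\<epsilon> \<le> \<epsilon>\<^sub>2" by simp_all
    show "\<epsilon> \<le> \<delta> * \<epsilon>\<^sub>1" "\<epsilon> \<le> \<delta> * \<epsilon>\<^sub>2" using \<delta> by (simp_all add: \<epsilon>_def)
  qed
  have "lower stuck \<epsilon> x g" if e: "e \<in> {x, x + 1}" and max: "\<And>e'. g e' \<le> g e + \<alpha>" for x g e
  proof (cases "e = x")
    case e: True
    show ?thesis
    proof (cases "g (x - 1) \<le> g (x + 1)")
      case True
      have "lower_at \<epsilon>\<^sub>1 (g (x - 1)) (g x) (g (x + 1)) (g (x + 2))"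
        using True max[of "x + 1"] max[of "x + 2"] e by (intro right) auto
      then show ?thesis
        by (rule lower_weaken[OF lower_atD]) (rule \<epsilon>(2))
    next
      case False
      let ?g = "bump \<alpha> x g"
      have "lower_at \<epsilon>\<^sub>2 (?g (x - 2)) (?g (x - 1)) (?g x) (?g (x + 1))"
        using False max[of "x - 1"] max[of "x - 2"] e \<alpha>_gt_1 by (intro left) (auto simp: bump_def)
      then have "lower stuck \<epsilon>\<^sub>2 (x - 1) ?g"
        using lower_atD[of \<epsilon>\<^sub>2 ?g "x - 1"] by (simp add: algebra_simps)
      from lower_left[OF stuck_sets this] have "lower stuck (sg \<beta> (g x - g (x + 1)) * \<epsilon>\<^sub>2) x g" .
      moreover have "\<delta> \<le> sg \<beta> (g x - g (x + 1))"
        unfolding \<delta>_def using max[of "x + 1"] e \<beta>_pos by (intro sg_mono) auto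
      then have "\<delta> * \<epsilon>\<^sub>2 \<le> sg \<beta> (g x - g (x + 1)) * \<epsilon>\<^sub>2"
        using \<epsilon>\<^sub>2 by simp
      ultimately show ?thesis
        using \<epsilon>(5) by (meson lower_weaken order_trans)
    qed
  next
    case False
    with e have e: "e = x + 1" by simp
    show ?thesis
    proof (cases "g (x + 2) \<le> g x")
      case True
      have "lower_at \<epsilon>\<^sub>2 (g (x - 1)) (g x) (g (x + 1)) (g (x + 2))"
        using True max[of x] max[of "x - 1"] e by (intro left) auto
      then show ?thesis
        by (rule lower_weaken[OF lower_atD]) (rule \<epsilon>(3))
    next
      case False
      let ?g = "bump \<alpha> (x + 1) g"
      have "lower_at \<epsilon>\<^sub>1 (?g x) (?g (x + 1)) (?g (x + 2)) (?g (x + 3))"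
        using False max[of "x + 2"] max[of "x + 3"] e \<alpha>_gt_1 by (intro right) (auto simp: bump_def)
      then have "lower stuck \<epsilon>\<^sub>1 (x + 1) ?g"
        using lower_atD[of \<epsilon>\<^sub>1 ?g "x + 1"] by (simp add: algebra_simps)
      from lower_right[OF stuck_sets this] have "lower stuck (sg \<beta> (g (x + 1) - g x) * \<epsilon>\<^sub>1) x g" .
      moreover have "\<delta> \<le> sg \<beta> (g (x + 1) - g x)"
        unfolding \<delta>_def using max[of x] e \<beta>_pos by (intro sg_mono) auto
      then have "\<delta> * \<epsilon>\<^sub>1 \<le> sg \<beta> (g (x + 1) - g x) * \<epsilon>\<^sub>1"
        using \<epsilon>\<^sub>1 by simp
      ultimately show ?thesis
        using \<epsilon>(4) by (meson lower_weaken order_trans)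
    qed
  qed
  with \<epsilon>(1) show ?thesis by (rule that)
qed

section \<open>Localization\<close>

lemma adapted_pot: "adapted (\<lambda>n p. P n (p n) (pot \<alpha> p n))"
  unfolding adapted_def using pot_cong by (metis order_refl)

lemma pred_gen_adapted:
  assumes "adapted G"
  shows "{\<omega> \<in> space M. \<exists>n. G n (\<lambda>i. X i \<omega>)} \<in> sets gen"
proof -
  note adapted_gen[OF assms, measurable]
  have "{\<omega> \<in> space gen. \<exists>n. G n (\<lambda>i. X i \<omega>)} \<in> sets gen"
    by measurable
  then show ?thesis unfolding space_gen .
qed

text \<open>As long as all potentials lie in \<open>[0, B]\<close>, every step has probability at
  least \<open>sg \<beta> (- B)\<close>. Crossing one edge back and forth adds \<alpha> - 1 each
  time, so \<open>B\<close> is exceeded after boundedly many steps with a probability bounded from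
  below.\<close>

lemma AE_pot_unbounded: "AE \<omega> in M. \<forall>B::nat. \<exists>n e. pot \<alpha> (\<lambda>i. X i \<omega>) n e > real B"
proof -
  have "AE \<omega> in M. \<exists>n e. pot \<alpha> (\<lambda>i. X i \<omega>) n e > real B" for B :: nat
  proof -
    let ?G = "\<lambda>n p. \<exists>e. pot \<alpha> p n e > real B"
    define A where "A = {\<omega> \<in> space M. \<exists>n. ?G n (\<lambda>i. X i \<omega>)}"
    have "adapted ?G"
      using adapted_pot[of "\<lambda>_ _ g. \<exists>e. g e > real B"] .
    then have A: "A \<in> sets gen"
      unfolding A_def by (rule pred_gen_adapted)
    note AM = gen_sets[OF A]
    define \<delta> where "\<delta> = sg \<beta> (- real B)"
    have \<delta>: "0 < \<delta>" by (simp add: \<delta>_def sg_pos)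
    have exceeded: "lower A 1 x g" if "g e > real B" for x g e
      unfolding lower_def
    proof (intro allI impI)
      fix n p assume "p n = x" "pot \<alpha> p n = g"
      have "cyl n p \<subseteq> A"
      proof
        fix \<omega> assume \<omega>: "\<omega> \<in> cyl n p"
        then have "pot \<alpha> (\<lambda>i. X i \<omega>) n = pot \<alpha> p n"
          by (intro pot_cong) (auto simp: cyl_def)
        with \<open>pot \<alpha> p n = g\<close> that have "pot \<alpha> (\<lambda>i. X i \<omega>) n e > real B" by simp
        with \<omega> show "\<omega> \<in> A"
          unfolding A_def cyl_def by blast
      qed
      then show "1 * prob (cyl n p) \<le> prob (A \<inter> cyl n p)"
        by (simp add: Int_absorb1)
    qed
    have "lower A (\<delta> ^ j) x g"
      if "\<And>e. 0 \<le> g e" "e \<in> {x, x + 1}" "g e + real j * (\<alpha> - 1) > real B" for j x g e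
      using that
    proof (induction j arbitrary: x g e)
      case 0
      then show ?case using exceeded by simp
    next
      case (Suc j)
      show ?case
      proof (cases "\<exists>e'. g e' > real B")
        case True
        then obtain e' where e': "g e' > real B" by blast
        have "\<delta> ^ Suc j \<le> 1"
          using \<delta> sg_le_1 by (intro power_le_one) (auto simp: \<delta>_def)
        with exceeded e' show ?thesis by (meson lower_weaken)
      next
        case False
        then have bd: "g i \<le> real B" for i by (simp add: not_less)
        have nonneg: "0 \<le> bump \<alpha> i g i'" for i i'
          using Suc.prems(1) \<alpha>_gt_1 by (simp add: bump_def)
        have big: "bump \<alpha> e g e + real j * (\<alpha> - 1) > real B"
          using Suc.prems(3) by (simp add: bump_def algebra_simps)
        consider "e = x" | "e = x + 1" using Suc.prems(2) by auto
        then show ?thesis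
        proof cases
          case 1
          have "lower A (\<delta> ^ j) (x - 1) (bump \<alpha> x g)"
            using nonneg big 1 by (intro Suc.IH[of _ e]) auto
          from lower_left[OF AM this] show ?thesis
          proof (rule lower_weaken)
            have "\<delta> \<le> sg \<beta> (g x - g (x + 1))"
              unfolding \<delta>_def using bd[of "x + 1"] Suc.prems(1)[of x] \<beta>_pos by (intro sg_mono) auto
            then show "\<delta> ^ Suc j \<le> sg \<beta> (g x - g (x + 1)) * \<delta> ^ j"
              using \<delta> by simp
          qed
        next
          case 2
          have "lower A (\<delta> ^ j) (x + 1) (bump \<alpha> (x + 1) g)"
            using nonneg big 2 by (intro Suc.IH[of _ e]) auto
          from lower_right[OF AM this] show ?thesis
          proof (rule lower_weaken)
            have "\<delta> \<le> sg \<beta> (g (x + 1) - g x)"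
              unfolding \<delta>_def using bd[of x] Suc.prems(1)[of "x + 1"] \<beta>_pos by (intro sg_mono) auto
            then show "\<delta> ^ Suc j \<le> sg \<beta> (g (x + 1) - g x) * \<delta> ^ j"
              using \<delta> by simp
          qed
        qed
      qed
    qed
    note lower = this
    obtain j :: nat where "real B / (\<alpha> - 1) < real j"
      using reals_Archimedean2 by blast
    then have j: "real B < real j * (\<alpha> - 1)"
      using \<alpha>_gt_1 by (simp add: field_simps)
    \<comment> \<open>The bound holds from every configuration, so \<open>G\<close> can be taken
      identically true.\<close>
    have "AE \<omega> in M. (\<exists>\<^sub>\<infinity>n::nat. True) \<longrightarrow> \<omega> \<in> A"
    proof (rule AE_infinitely_often_imp[OF A, where G = "\<lambda>_ _. True" and \<epsilon> = "\<delta> ^ j"])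
      fix n p
      have "lower A (\<delta> ^ j) (p n) (pot \<alpha> p n)"
      proof (rule lower)
        show "0 \<le> pot \<alpha> p n e" for e by (rule pot_nonneg[OF \<alpha>_gt_1])
        show "real B < pot \<alpha> p n (p n) + real j * (\<alpha> - 1)"
          using j pot_nonneg[OF \<alpha>_gt_1, of p n "p n"] by linarith
      qed simp
      then show "\<delta> ^ j * prob (cyl n p) \<le> prob (A \<inter> cyl n p)"
        by (simp add: lower_def)
    qed (simp_all add: \<delta> adapted_def)
    then show ?thesis
      by (rule AE_mp) (auto simp: A_def INFM_const intro!: AE_I2)
  qed
  then show ?thesis by (simp add: AE_all_countable)
qed

text \<open>The tolerance \<alpha> is the most that one crossing can add to an edge.\<close>

definition near_max :: "nat \<Rightarrow> (nat \<Rightarrow> int) \<Rightarrow> bool" where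
  "near_max n p \<longleftrightarrow> (\<exists>e\<in>{p n, p n + 1}. \<forall>e'. pot \<alpha> p n e' \<le> pot \<alpha> p n e + \<alpha>)"

text \<open>A potential that exceeds all earlier ones is created on an edge at or next to the walk.\<close>
lemma pot_bounded_if_not_near_max:
  assumes nn: "\<And>n. p (Suc n) = p n + 1 \<or> p (Suc n) = p n - 1"
    and far: "\<And>n. n \<ge> n\<^sub>0 \<Longrightarrow> \<not> near_max n p" and B: "\<And>e. pot \<alpha> p n\<^sub>0 e \<le> B"
  shows "pot \<alpha> p (n\<^sub>0 + m) e \<le> B"
proof (induction m arbitrary: e)
  case 0
  then show ?case using B by simp
next
  case (Suc m)
  define n g g' where "n = n\<^sub>0 + m" and "g = pot \<alpha> p n" and "g' = pot \<alpha> p (Suc n)"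
  have IH: "g i \<le> B" for i using Suc by (simp add: g_def n_def)
  \<comment> \<open>A crossing cannot lift the two edges at the old site above
    \<open>B\<close>.\<close>
  have far_edge: "g i < B - \<alpha>" if i: "i \<in> {p n, p n + 1}" for i
  proof -
    have "\<not> near_max n p" using far by (simp add: n_def)
    then obtain e' where "g e' > g i + \<alpha>"
      using i unfolding near_max_def g_def by (meson not_le)
    with IH[of e'] show ?thesis by linarith
  qed
  have far': "\<exists>e'. g' e' > g' i + \<alpha>" if "i \<in> {p (Suc n), p (Suc n) + 1}" for i
  proof -
    have "\<not> near_max (Suc n) p" using far by (simp add: n_def)
    then show ?thesis
      using that unfolding near_max_def g'_def by (meson not_le)
  qed
  \<comment> \<open>The crossing raises these two edges and one further edge \<open>i\<close>, which
    touches the walk after the step.\<close>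
  have bump: "\<exists>c i. g' = bump \<alpha> c g \<and> {c - 1, c, c + 1} = insert i {p n, p n + 1}
      \<and> i \<in> {p (Suc n), p (Suc n) + 1}"
  proof (cases "p (Suc n) = p n + 1")
    case True
    then have "g' = bump \<alpha> (p n + 1) g"
      unfolding g'_def g_def by (rule pot_Suc_right)
    with True show ?thesis by (intro exI[of _ "p n + 1"] exI[of _ "p n + 2"]) auto
  next
    case False
    with nn[of n] have *: "p (Suc n) = p n - 1" by simp
    then have "g' = bump \<alpha> (p n) g"
      unfolding g'_def g_def by (rule pot_Suc_left)
    with * show ?thesis by (intro exI[of _ "p n"] exI[of _ "p n - 1"]) auto
  qed
  then obtain c i where g': "g' = bump \<alpha> c g" and c: "{c - 1, c, c + 1} = insert i {p n, p n + 1}"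
    and i: "i \<in> {p (Suc n), p (Suc n) + 1}" by blast
  have other: "g' e \<le> B" if "e \<noteq> i" for e
  proof (cases "e \<in> {c - 1, c, c + 1}")
    case True
    with c that have "e \<in> {p n, p n + 1}" by blast
    from far_edge[OF this] show ?thesis
      using \<alpha>_gt_1 by (auto simp: g' bump_def)
  next
    case False
    then show ?thesis using IH by (simp add: g' bump_def)
  qed
  \<comment> \<open>The walk is not near the maximum after the step either, so another edge exceeds
    \<open>i\<close>, and that edge respects \<open>B\<close>.\<close>
  have "g' i \<le> B"
  proof -
    obtain e' where e': "g' e' > g' i + \<alpha>" using far'[OF i] by blast
    with \<alpha>_gt_1 have "e' \<noteq> i" by auto
    from other[OF this] e' \<alpha>_gt_1 show ?thesis by linarith
  qed
  with other have "g' e \<le> B" by (cases "e = i") simp_all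
  then show ?case by (simp add: g'_def n_def)
qed

lemma pot_mono: "m \<le> n \<Longrightarrow> pot \<alpha> p m e \<le> pot \<alpha> p n e"
proof -
  assume "m \<le> n"
  then have "edge_local_time p m j \<le> edge_local_time p n j" for j
    by (induction n rule: dec_induct) (auto simp: edge_local_time_Suc)
  then show ?thesis
    using \<alpha>_gt_1 unfolding pot_def by (intro add_mono mult_left_mono) auto
qed

lemma pot_le: "pot \<alpha> p n e \<le> (3 * \<alpha> - 1) * real n"
proof -
  have l: "edge_local_time p n j \<le> n" for j
    by (induction n) (simp add: edge_local_time_def, simp add: edge_local_time_Suc)
  have "pot \<alpha> p n e \<le> (\<alpha> - 1) * real n + \<alpha> * (real n + real n)"
    unfolding pot_def using \<alpha>_gt_1 l by (intro add_mono mult_left_mono) auto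
  then show ?thesis by (simp add: algebra_simps)
qed

lemma AE_infinitely_often_near_max: "AE \<omega> in M. \<exists>\<^sub>\<infinity>n. near_max n (\<lambda>i. X i \<omega>)"
  using AE_nearest_neighbour AE_pot_unbounded
proof eventually_elim
  case (elim \<omega>)
  let ?p = "\<lambda>i. X i \<omega>"
  show ?case
  proof (rule ccontr)
    assume "\<not> (\<exists>\<^sub>\<infinity>n. near_max n ?p)"
    then obtain n\<^sub>0 where n\<^sub>0: "\<And>n. n \<ge> n\<^sub>0 \<Longrightarrow> \<not> near_max n ?p"
      unfolding INFM_nat_le by blast
    define B where "B = (3 * \<alpha> - 1) * real n\<^sub>0"
    have le: "pot \<alpha> ?p (n\<^sub>0 + m) e \<le> B" for m e
      using elim(1) n\<^sub>0 pot_le unfolding B_def by (intro pot_bounded_if_not_near_max) auto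
    have "pot \<alpha> ?p n e \<le> B" for n e
      using pot_mono[of n "n\<^sub>0 + n" ?p e] le[of n e] by linarith
    moreover obtain N :: nat where "B \<le> real N" using real_arch_simple by blast
    ultimately show False
      using elim(2) by (meson not_le order_trans)
  qed
qed

lemma AE_stuck: "AE \<omega> in M. \<omega> \<in> stuck"
proof -
  obtain \<epsilon> where \<epsilon>: "\<epsilon> > 0"
    and lower: "\<And>x g e. e \<in> {x, x + 1} \<Longrightarrow> (\<And>e'. g e' \<le> g e + \<alpha>) \<Longrightarrow> lower stuck \<epsilon> x g"
    using lower_stuck_near_max by blast
  have "adapted near_max"
    using adapted_pot[of "\<lambda>_ x g. \<exists>e\<in>{x, x + 1}. \<forall>e'. g e' \<le> g e + \<alpha>"]
    unfolding near_max_def[abs_def] .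
  then have "AE \<omega> in M. (\<exists>\<^sub>\<infinity>n. near_max n (\<lambda>i. X i \<omega>)) \<longrightarrow> \<omega> \<in> stuck"
  proof (rule AE_infinitely_often_imp[OF stuck_gen _ \<epsilon>])
    fix n p assume "near_max n p"
    then have "lower stuck \<epsilon> (p n) (pot \<alpha> p n)"
      unfolding near_max_def using lower by blast
    then show "\<epsilon> * prob (cyl n p) \<le> prob (stuck \<inter> cyl n p)"
      by (simp add: lower_def)
  qed
  with AE_infinitely_often_near_max show ?thesis
    by eventually_elim simp
qed

subsection \<open>Two sites do not suffice\<close>

text \<open>Every step crosses edge \<open>x + 1\<close>, which gains \<alpha> - 1 while its
  neighbour \<open>x\<close> gains \<alpha>.\<close>

lemma two_sites_pot_diff:
  assumes nn: "\<And>n. p (Suc n) = p n + 1 \<or> p (Suc n) = p n - 1"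
    and stay: "\<And>m. m \<ge> n\<^sub>0 \<Longrightarrow> p m \<in> {x, x + 1 :: int}"
  shows "pot \<alpha> p (n\<^sub>0 + m) x - pot \<alpha> p (n\<^sub>0 + m) (x + 1)
    = pot \<alpha> p n\<^sub>0 x - pot \<alpha> p n\<^sub>0 (x + 1) + real m"
proof (induction m)
  case (Suc m)
  let ?n = "n\<^sub>0 + m"
  have "pot \<alpha> p (Suc ?n) = bump \<alpha> (x + 1) (pot \<alpha> p ?n)"
  proof (cases "p ?n = x")
    case True
    with nn[of ?n] stay[of "Suc ?n"] have "p (Suc ?n) = p ?n + 1" by auto
    from pot_Suc_right[OF this] True show ?thesis by simp
  next
    case False
    with stay[of ?n] have "p ?n = x + 1" by auto
    with nn[of ?n] stay[of "Suc ?n"] have "p (Suc ?n) = p ?n - 1" by auto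
    from pot_Suc_left[OF this] \<open>p ?n = x + 1\<close> show ?thesis by simp
  qed
  with Suc show ?case by (simp add: bump_def)
qed simp

text \<open>A walk confined to two sites would be infinitely often at \<open>x\<close> with edge
  \<open>x\<close> at least as heavy as \<open>x + 1\<close>, and each time it leaves to the left
  with probability at least 1/2.\<close>

lemma AE_leaves_two_sites: "AE \<omega> in M. \<forall>x n\<^sub>0. \<exists>m\<ge>n\<^sub>0. X m \<omega> \<notin> {x, x + 1}"
proof -
  have "AE \<omega> in M. \<exists>m\<ge>n\<^sub>0. X m \<omega> \<notin> {x, x + 1}" for x n\<^sub>0
  proof -
    define A where "A = {\<omega> \<in> space M. \<exists>m\<ge>n\<^sub>0. X m \<omega> \<notin> {x, x + 1}}"
    note pred_gen_X [measurable]
    have "{\<omega> \<in> space gen. \<exists>m\<ge>n\<^sub>0. X m \<omega> \<notin> {x, x + 1}} \<in> sets gen"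
      by measurable
    then have A: "A \<in> sets gen" unfolding A_def space_gen .
    note [measurable] = gen_sets[OF A]
    define G where "G n p \<longleftrightarrow> n\<^sub>0 \<le> n \<and> p n = x \<and> pot \<alpha> p n (x + 1) \<le> pot \<alpha> p n x" for n p
    have "adapted G"
      using adapted_pot[of "\<lambda>n y g. n\<^sub>0 \<le> n \<and> y = x \<and> g (x + 1) \<le> g x"]
      unfolding G_def[abs_def] .
    have "AE \<omega> in M. (\<exists>\<^sub>\<infinity>n. G n (\<lambda>i. X i \<omega>)) \<longrightarrow> \<omega> \<in> A"
    proof (rule AE_infinitely_often_imp[OF A \<open>adapted G\<close>, where \<epsilon> = "1 / 2"])
      fix n p assume G: "G n p"
      let ?p = "p(Suc n := p n - 1)"
      have "cyl (Suc n) ?p \<subseteq> A \<inter> cyl n p"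
        using G unfolding cyl_Suc_upd A_def G_def cyl_def by (auto intro!: exI[of _ "Suc n"])
      then have "prob (cyl (Suc n) ?p) \<le> prob (A \<inter> cyl n p)"
        by (rule finite_measure_mono) simp
      moreover have "1 / 2 \<le> sg \<beta> (pot \<alpha> p n (p n) - pot \<alpha> p n (p n + 1))"
        using sg_mono[OF \<beta>_pos, of 0 "pot \<alpha> p n (p n) - pot \<alpha> p n (p n + 1)"] G
        by (simp add: G_def sg_def)
      then have "1 / 2 * prob (cyl n p) \<le> prob (cyl (Suc n) ?p)"
        unfolding prob_cyl_left by (rule mult_right_mono) simp
      ultimately show "1 / 2 * prob (cyl n p) \<le> prob (A \<inter> cyl n p)" by linarith
    qed simp
    with AE_nearest_neighbour show ?thesis
    proof eventually_elim
      case (elim \<omega>)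
      let ?p = "\<lambda>i. X i \<omega>"
      show ?case
      proof (rule ccontr)
        assume "\<not> (\<exists>m\<ge>n\<^sub>0. X m \<omega> \<notin> {x, x + 1})"
        then have stay: "X m \<omega> \<in> {x, x + 1}" if "m \<ge> n\<^sub>0" for m
          using that by blast
        obtain M\<^sub>0 :: nat where M\<^sub>0: "pot \<alpha> ?p n\<^sub>0 (x + 1) - pot \<alpha> ?p n\<^sub>0 x \<le> real M\<^sub>0"
          using real_arch_simple by blast
        have "\<exists>n\<ge>k. G n ?p" for k
        proof -
          \<comment> \<open>After \<open>M\<^sub>0\<close> steps the initial deficit is made up; one
            more step, if necessary, puts the walk at \<open>x\<close>.\<close>
          define n where "n = n\<^sub>0 + (M\<^sub>0 + k)"
          define n' where "n' = (if X n \<omega> = x then n else Suc n)"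
          have "X n' \<omega> = x"
            using stay[of n] stay[of "Suc n"] elim(1)[rule_format, of n]
            by (auto simp: n'_def n_def)
          moreover have "pot \<alpha> ?p n' (x + 1) \<le> pot \<alpha> ?p n' x"
            using two_sites_pot_diff[of ?p n\<^sub>0 x "n' - n\<^sub>0"] elim(1) stay M\<^sub>0
            by (auto simp: n'_def n_def Suc_diff_le split: if_splits)
          moreover have "n' \<ge> k" "n' \<ge> n\<^sub>0" by (auto simp: n'_def n_def)
          ultimately show ?thesis unfolding G_def by blast
        qed
        then have "\<exists>\<^sub>\<infinity>n. G n ?p" by (simp add: INFM_nat_le)
        with elim(2) have "\<omega> \<in> A" by blast
        with stay show False unfolding A_def by blast
      qed
    qed
  qed
  then show ?thesis by (simp add: AE_all_countable)
qed

end

section \<open>The sites visited infinitely often\<close>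

lemma R_inf_iff: "j \<in> R_inf X \<omega> \<longleftrightarrow> (\<forall>n. \<exists>m\<ge>n. X m \<omega> = j)"
proof -
  have "j \<in> R_inf X \<omega> \<longleftrightarrow> (\<exists>\<^sub>\<infinity>m. 1 \<le> m \<and> X m \<omega> = j)"
    by (simp add: R_inf_def Inf_many_def)
  also have "\<dots> \<longleftrightarrow> (\<forall>n. \<exists>m\<ge>n. X m \<omega> = j)"
    unfolding INFM_nat_le by (metis le_trans linear)
  finally show ?thesis .
qed

theorem mainTheorem2:
  fixes M :: "'w measure" and \<alpha> \<beta> :: real and X :: "nat \<Rightarrow> 'w \<Rightarrow> int"
  assumes "prob_space M" and "\<beta> > 0" and "\<alpha> > 1" and "is_walk M \<alpha> \<beta> X"
  shows "AE \<omega> in M. finite (R_inf X \<omega>) \<and> card (R_inf X \<omega>) = 3"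
proof -
  interpret walk M \<alpha> \<beta> X
    using assms by (intro walk.intro walk_axioms.intro)
  show ?thesis
    using AE_nearest_neighbour AE_stuck AE_leaves_two_sites
  proof eventually_elim
    case (elim \<omega>)
    obtain z n where stay: "\<And>m. m \<ge> n \<Longrightarrow> X m \<omega> \<in> {z - 1, z, z + 1}"
      using elim(2) unfolding stuck_def by blast
    \<comment> \<open>Leaving \<open>{z, z + 1}\<close> infinitely often forces visits to
      \<open>z - 1\<close>, and symmetrically for \<open>z + 1\<close>; the middle site is visited
      at every other step.\<close>
    have "R_inf X \<omega> = {z - 1, z, z + 1}"
    proof (intro equalityI subsetI)
      fix j assume "j \<in> R_inf X \<omega>"
      then show "j \<in> {z - 1, z, z + 1}"
        using stay unfolding R_inf_iff by metis
    next
      fix j assume "j \<in> {z - 1, z, z + 1}"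
      then consider "j = z - 1" | "j = z" | "j = z + 1" by blast
      then have "\<exists>m\<ge>k. X m \<omega> = j" for k
      proof cases
        case 1
        obtain m where m: "m \<ge> max n k" "X m \<omega> \<notin> {z, z + 1}"
          using elim(3) by blast
        with stay[of m] 1 show ?thesis by auto
      next
        case 2
        show ?thesis
        proof (cases "X (max n k) \<omega> = z")
          case True
          with 2 show ?thesis by (intro exI[of _ "max n k"]) auto
        next
          case False
          moreover have "n \<le> max n k" "n \<le> Suc (max n k)" by auto
          note stay[OF this(1)] stay[OF this(2)]
          moreover note elim(1)[rule_format, of "max n k"]
          ultimately
          have "X (Suc (max n k)) \<omega> = z" by auto
          with 2 show ?thesis by (intro exI[of _ "Suc (max n k)"]) auto
        qed
      next
        case 3
        obtain m where m: "m \<ge> max n k" "X m \<omega> \<notin> {z - 1, z - 1 + 1}"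
          using elim(3) by blast
        with stay[of m] 3 show ?thesis by auto
      qed
      then show "j \<in> R_inf X \<omega>" unfolding R_inf_iff by blast
    qed
    then show ?case by simp
  qed
qed

end
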